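(* In the setting of the context, suppose Assumptions (A1), (A2), (A3) hold. Fix $i\in[d^\star]$ and a premium rate $r>0$ with $r>\mathbb{E}[\boldsymbol{U}_{(i)}](\boldsymbol{I}-\boldsymbol{H})^{-1}\overline{\boldsymbol{\lambda}}$, and suppose there is $\theta^\star>0$ with $\Psi_i(\theta^\star)=0$. Let $Y_i(t)=Z_i(t)-rt$, $\tau_u=\inf\{t>0:Y_i(t)>u\}$ and $p(u)=\mathbb{P}(\tau_u<\infty)$. Then, for all $u>0$, $$p(u)\le e^{-\theta^\star u}.$$
   Context: Fix $d,d^\star\in\mathbb{N}$ (possibly different); $[d]=\{1,\dots,d\}$, $\mathbb{R}_+=[0,\infty)$; vector inequalities are componentwise. Hawkes process. Given: base rates $\overline\lambda_j\ge0$, $j\in[d]$, at least one strictly positive, $\overline{\boldsymbol\lambda}=(\overline\lambda_1,\dots,\overline\lambda_d)^\top$; decay functions $g_{ij}:\mathbb{R}_+\to\mathbb{R}_+$, $i,j\in[d]$, non-increasing and integrable, with $c_{ij}=\int_0^\infty g_{ij}(v)\,dv$; for each $j\in[d]$ a non-negative, non-degenerate random mark vector $\boldsymbol{B}_j=(B_{1j},\dots,B_{dj})$ (entries may be dependent). Each event in component $j$ carries an independent copy of $\boldsymbol{B}_j$. Immigrant events in component $j$ arrive on $(0,\infty)$ according to a homogeneous Poisson process of rate $\overline\lambda_j$, independently over $j$. Each event (immigrant or not) in component $j$ at time $T$ with mark $\boldsymbol{B}_{j,r}$ generates, independently of everything else given its mark, offspring events in each component $m\in[d]$ on $(T,\infty)$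 according to an inhomogeneous Poisson process with intensity $B_{mj,r}\,g_{mj}(\cdot-T)$; iterate over generations. $N_j(t)$ is the number of events (over all generations) in component $j$ in $(0,t]$, $\boldsymbol{N}(0)=\boldsymbol{0}$. The cluster of an immigrant in component $j$ consists of the immigrant and all its descendants; $S_{i\leftarrow j}$ is the total number of events in component $i$ in such a cluster (the immigrant being counted in component $j$). Compound process. For each $j\in[d]$ let $\boldsymbol{U}_{j,r}=(U_{1j,r},\dots,U_{d^\star j,r})^\top$, $r\in\mathbb{N}$, be i.i.d. copies of a non-negative, non-degenerate random vector $\boldsymbol{U}_j=(U_{1j},\dots,U_{d^\star j})^\top$ (entries may be dependent), drawn independently for every event; $Z_i(t)=\sum_{j=1}^d\sum_{r=1}^{N_j(t)}U_{ij,r}$, $i\in[d^\star]$. Write $m_{\boldsymbol{U}_l}(\boldsymbol{\theta})=\mathbb{E}[e^{\boldsymbol{\theta}^\top\boldsymbol{U}_l}]$, $\boldsymbol{m}_{\boldsymbol{U}}(\boldsymbol{\theta})=(m_{\boldsymbol{U}_1}(\boldsymbol{\theta}),\dots,m_{\boldsymbol{U}_d}(\boldsymbol{\theta}))^\top$, $m_{U_{il}}(\theta)=\mathbb{E}[e^{\theta U_{il}}]$ and $\mathbb{E}[\boldsymbol{U}_{(i)}]=(\mathbb{E}[U_{i1}],\dots,\mathbb{E}[U_{id}])$ (row vector). Let $\Lambda_i(\theta)=\sum_{j=1}^d\overline\lambda_j\big(\mathbb{E}\big[\prod_{l=1}^dm_{U_{il}}(\theta)^{S_{l\leftarrow j}}\big]-1\big)$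 and $\Psi_i(\theta)=\Lambda_i(\theta)-r\theta$. Assumptions. (A1) The matrix $\boldsymbol{H}=(h_{mj})_{m,j\in[d]}$, $h_{mj}=\mathbb{E}[B_{mj}]c_{mj}$, has spectral radius strictly less than $1$. (A2) There is $\boldsymbol{\vartheta}\in\mathbb{R}^d$ with strictly positive entries such that $\mathbb{E}\big[\exp(\sum_{m=1}^dB_{mj}\vartheta_m)\big]<\infty$ for all $j\in[d]$. (A3) For a vector $\boldsymbol{r}$ with positive entries, let $\hat{\boldsymbol{x}}$ be the solution $\boldsymbol{x}$ of the system, $j\in[d]$, $$x_j\sum_{k=1}^d r_k\,\mathbb{E}\Big[B_{kj}c_{kj}\exp\Big(\sum_{m=1}^dB_{mj}c_{mj}(x_m-1)\Big)\Big]=r_j\,\mathbb{E}\Big[\exp\Big(\sum_{m=1}^dB_{mj}c_{mj}(x_m-1)\Big)\Big],$$ and let $\hat z_j=r_j\Big(\sum_{k=1}^dr_k\,\mathbb{E}\big[B_{kj}c_{kj}\exp(\sum_{m=1}^dB_{mj}c_{mj}(\hat x_m-1))\big]\Big)^{-1}$. For any $\hat{\boldsymbol{z}}=(\hat z_1,\dots,\hat z_d)^\top$ so obtained (from any positive $\boldsymbol{r}$) there exists $\hat{\boldsymbol{\theta}}\in\mathbb{R}^{d^\star}$ with $\boldsymbol{m}_{\boldsymbol{U}}(\hat{\boldsymbol{\theta}})=\hat{\boldsymbol{z}}$. *)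

theory Defs
  imports "HOL-Probability.Probability"
begin

text \<open>
  Conventions: the component sets \<open>[d]\<close> and \<open>[d*]\<close> are the finite index types
  \<open>'d\<close> and \<open>'s\<close>. A doubly indexed quantity \<open>x\<^sub>m\<^sub>j\<close> of the
  mathematics is written \<open>x m j\<close> (target component first), and the random vectors
  \<open>B\<^sub>j\<close>, \<open>U\<^sub>j\<close> are represented by their laws \<open>B j\<close>, \<open>U j\<close>, so that the
  expectation of \<open>f(B\<^sub>j)\<close> is \<open>\<integral>b. f b \<partial>B j\<close>.
\<close>

subsection \<open>Counting with values in the extended naturals\<close>

definition ecount :: "'a set \<Rightarrow> enat" where
  "ecount A = (if finite A then enat (card A) else \<infinity>)"

text \<open>The powers \<open>x ^ n\<close> are monotone in \<open>n\<close>, so for exponent \<open>\<infinity>\<close> the limit exists.\<close>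

definition epower :: "ennreal \<Rightarrow> enat \<Rightarrow> ennreal" where
  "epower x n = (case n of enat k \<Rightarrow> x ^ k | \<infinity> \<Rightarrow> liminf (\<lambda>k. x ^ k))"

subsection \<open>Poisson processes with a random intensity\<close>

text \<open>
  A point process on \<open>(0,\<infinity>)\<close> is given by an enumeration \<open>T 0, T 1, \<dots>\<close> of its points in an
  arbitrary order; the value \<open>\<infinity>\<close> means that the corresponding point does not exist.
\<close>

definition npoints :: "(nat \<Rightarrow> ereal) \<Rightarrow> real set \<Rightarrow> enat" where
  "npoints T A = ecount {k. T k \<in> ereal ` A}"

definition poisson_weight :: "real \<Rightarrow> nat \<Rightarrow> real" where
  "poisson_weight \<mu> k = exp (- \<mu>) * \<mu> ^ k / fact k"

text \<open>
  Given \<open>X\<close>, the processes \<open>T m\<close> are independent inhomogeneous Poisson processes with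
  intensities \<open>\<phi> X m\<close>: given \<open>X\<close>, the numbers of points of component \<open>m\<close> in disjoint bounded
  Borel sets \<open>A\<close> are independent (also over \<open>m\<close>) and Poisson distributed with mean the
  integral of \<open>\<phi> X m\<close> over \<open>A\<close>. These probabilities determine the joint law
  of \<open>X\<close> and the counting measures of the \<open>T m\<close>.
\<close>

definition cond_poisson_process ::
    "'w measure \<Rightarrow> 'x measure \<Rightarrow> ('w \<Rightarrow> 'x) \<Rightarrow> ('x \<Rightarrow> 'd::finite \<Rightarrow> real \<Rightarrow> real)
      \<Rightarrow> ('d \<Rightarrow> nat \<Rightarrow> 'w \<Rightarrow> ereal) \<Rightarrow> bool" where
  "cond_poisson_process M N X \<phi> T \<longleftrightarrow>
     X \<in> measurable M N \<and>
     (\<forall>m k. T m k \<in> borel_measurable M \<and> (\<forall>\<omega>\<in>space M. 0 < T m k \<omega>)) \<and>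
     (\<forall>C\<in>sets N. \<forall>(n::nat) (A :: nat \<Rightarrow> real set) (\<kappa> :: nat \<Rightarrow> 'd \<Rightarrow> nat).
        (\<forall>i<n. A i \<in> sets borel \<and> bounded (A i) \<and> A i \<subseteq> {0<..}) \<longrightarrow>
        disjoint_family_on A {..<n} \<longrightarrow>
        measure M {\<omega>\<in>space M. X \<omega> \<in> C \<and>
            (\<forall>i<n. \<forall>m. npoints (\<lambda>k. T m k \<omega>) (A i) = enat (\<kappa> i m))} =
        (\<integral>\<omega>. indicator C (X \<omega>) *
            (\<Prod>i<n. \<Prod>m\<in>UNIV. poisson_weight (LBINT s:A i. \<phi> (X \<omega>) m s) (\<kappa> i m)) \<partial>M))"

definition poisson_process ::
    "'w measure \<Rightarrow> ('d::finite \<Rightarrow> real \<Rightarrow> real) \<Rightarrow> ('d \<Rightarrow> nat \<Rightarrow> 'w \<Rightarrow> ereal) \<Rightarrow> bool" where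
  "poisson_process M \<phi> T \<longleftrightarrow>
     cond_poisson_process M (count_space (UNIV :: unit set)) (\<lambda>\<omega>. ()) (\<lambda>_. \<phi>) T"

subsection \<open>The cluster representation of the Hawkes process\<close>

text \<open>
  Labels of potential events: \<open>Immigrant j k\<close> is the \<open>k\<close>-th immigrant in component \<open>j\<close>, and
  \<open>Offspring e m k\<close> is the \<open>k\<close>-th child in component \<open>m\<close> of the event \<open>e\<close>. A potential event is
  an actual one iff its time is finite.
\<close>

datatype 'd event = Immigrant 'd nat | Offspring "'d event" 'd nat

fun component :: "'d event \<Rightarrow> 'd" where
  "component (Immigrant j k) = j"
| "component (Offspring e m k) = m"

fun ancestor :: "'d event \<Rightarrow> 'd event" where
  "ancestor (Immigrant j k) = Immigrant j k"
| "ancestor (Offspring e m k) = ancestor e"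

text \<open>
  \<open>imm j k\<close> is the arrival time of an immigrant, and \<open>delay e m k\<close> is the time between the
  event \<open>e\<close> and its \<open>k\<close>-th child in component \<open>m\<close>.
\<close>

fun event_time ::
    "('d \<Rightarrow> nat \<Rightarrow> 'w \<Rightarrow> ereal) \<Rightarrow> ('d event \<Rightarrow> 'd \<Rightarrow> nat \<Rightarrow> 'w \<Rightarrow> ereal) \<Rightarrow> 'd event \<Rightarrow> 'w \<Rightarrow> ereal"
  where
  "event_time imm delay (Immigrant j k) \<omega> = imm j k \<omega>"
| "event_time imm delay (Offspring e m k) \<omega> = event_time imm delay e \<omega> + delay e m k \<omega>"

definition hawkes_count ::
    "('d \<Rightarrow> nat \<Rightarrow> 'w \<Rightarrow> ereal) \<Rightarrow> ('d event \<Rightarrow> 'd \<Rightarrow> nat \<Rightarrow> 'w \<Rightarrow> ereal) \<Rightarrow> 'd \<Rightarrow> real \<Rightarrow> 'w \<Rightarrow> enat"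
  where
  "hawkes_count imm delay j t \<omega> =
     ecount {e. component e = j \<and> event_time imm delay e \<omega> \<in> {0<..ereal t}}"

fun in_cluster :: "('d event \<Rightarrow> 'd \<Rightarrow> nat \<Rightarrow> 'w \<Rightarrow> ereal) \<Rightarrow> 'd event \<Rightarrow> 'w \<Rightarrow> bool" where
  "in_cluster delay (Immigrant j k) \<omega> = True"
| "in_cluster delay (Offspring e m k) \<omega> = (in_cluster delay e \<omega> \<and> delay e m k \<omega> < \<infinity>)"

text \<open>
  \<open>S\<^sub>i\<^sub>\<leftarrow>\<^sub>j\<close>. The clusters of all immigrants in component \<open>j\<close> have the same law
  and do not depend on the arrival time of the immigrant; we use the label \<open>Immigrant j 0\<close>.
\<close>

definition cluster_size ::
    "('d event \<Rightarrow> 'd \<Rightarrow> nat \<Rightarrow> 'w \<Rightarrow> ereal) \<Rightarrow> 'd \<Rightarrow> 'd \<Rightarrow> 'w \<Rightarrow> enat" where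
  "cluster_size delay i j \<omega> =
     ecount {e. ancestor e = Immigrant j 0 \<and> component e = i \<and> in_cluster delay e \<omega>}"

subsection \<open>The standing assumptions on the compound Hawkes process\<close>

text \<open>\<open>Reproduction e\<close> comprises the mark of \<open>e\<close> and the delays of its children.\<close>

datatype 'd source = Immigration | Reproduction "'d event" | Claim 'd nat

locale compound_hawkes = prob_space M
  for M :: "'w measure" +
  fixes base :: "real ^ 'd::finite"
    and g :: "'d \<Rightarrow> 'd \<Rightarrow> real \<Rightarrow> real"
    and B :: "'d \<Rightarrow> (real ^ 'd) measure"
    and U :: "'d \<Rightarrow> (real ^ 's::finite) measure"
    and imm :: "'d \<Rightarrow> nat \<Rightarrow> 'w \<Rightarrow> ereal"
    and mark :: "'d event \<Rightarrow> 'w \<Rightarrow> real ^ 'd"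
    and delay :: "'d event \<Rightarrow> 'd \<Rightarrow> nat \<Rightarrow> 'w \<Rightarrow> ereal"
    and claim :: "'d \<Rightarrow> nat \<Rightarrow> 'w \<Rightarrow> real ^ 's"
  assumes base_nonneg: "0 \<le> base $ j"
    and base_pos: "\<exists>j. 0 < base $ j"
    and g_nonneg: "0 \<le> s \<Longrightarrow> 0 \<le> g m j s"
    and g_antimono: "antimono_on {0..} (g m j)"
    and g_integrable: "set_integrable lborel {0..} (g m j)"
    and B_nonneg: "AE b in B j. \<forall>m. 0 \<le> b $ m"
    and B_nondegenerate: "\<not> (\<exists>b0. AE b in B j. b = b0)"
    and U_nonneg: "AE v in U j. \<forall>i. 0 \<le> v $ i"
    and U_nondegenerate: "\<not> (\<exists>v0. AE v in U j. v = v0)"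
    and immigration: "poisson_process M (\<lambda>j s. base $ j) imm"
    and mark_law: "distr M borel (mark e) = B (component e)"
    and reproduction:
      "cond_poisson_process M borel (mark e) (\<lambda>b m s. b $ m * g m (component e) s) (delay e)"
    and claim_measurable: "claim j r \<in> borel_measurable M"
    and claim_law: "distr M borel (claim j r) = U j"
    and independent: "indep_sets
      (\<lambda>x. case x of
          Immigration \<Rightarrow> sets (vimage_algebra (space M)
            (\<lambda>\<omega>. \<lambda>(j, k). imm j k \<omega>)
            (\<Pi>\<^sub>M p\<in>(UNIV :: ('d \<times> nat) set). borel))
        | Reproduction e \<Rightarrow> sets (vimage_algebra (space M)
            (\<lambda>\<omega>. (mark e \<omega>, \<lambda>(m, k). delay e m k \<omega>))
            (borel \<Otimes>\<^sub>M (\<Pi>\<^sub>M p\<in>(UNIV :: ('d \<times> nat) set). borel)))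
        | Claim j r \<Rightarrow> sets (vimage_algebra (space M) (claim j r) borel))
      UNIV"

subsection \<open>The assumptions (A1), (A2), (A3)\<close>

definition cint :: "('d \<Rightarrow> 'd \<Rightarrow> real \<Rightarrow> real) \<Rightarrow> 'd \<Rightarrow> 'd \<Rightarrow> real" where
  "cint g m j = (LBINT v:{0..}. g m j v)"

definition branching_matrix ::
    "('d \<Rightarrow> (real ^ 'd) measure) \<Rightarrow> ('d \<Rightarrow> 'd \<Rightarrow> real \<Rightarrow> real) \<Rightarrow> real ^ 'd ^ 'd::finite" where
  "branching_matrix B g = (\<chi> m j. (\<integral>b. b $ m \<partial>B j) * cint g m j)"

definition complex_eigenvalues :: "real ^ 'n ^ 'n::finite \<Rightarrow> complex set" where
  "complex_eigenvalues A =
     {z. \<exists>v :: complex ^ 'n. v \<noteq> 0 \<and> (\<chi> i j. complex_of_real (A $ i $ j)) *v v = z *s v}"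

definition spectral_radius :: "real ^ 'n ^ 'n::finite \<Rightarrow> real" where
  "spectral_radius A = Max (cmod ` complex_eigenvalues A)"

definition assumption_A1 ::
    "('d \<Rightarrow> (real ^ 'd::finite) measure) \<Rightarrow> ('d \<Rightarrow> 'd \<Rightarrow> real \<Rightarrow> real) \<Rightarrow> bool" where
  "assumption_A1 B g \<longleftrightarrow> spectral_radius (branching_matrix B g) < 1"

definition assumption_A2 :: "('d \<Rightarrow> (real ^ 'd::finite) measure) \<Rightarrow> bool" where
  "assumption_A2 B \<longleftrightarrow>
     (\<exists>\<theta> :: real ^ 'd. (\<forall>m. 0 < \<theta> $ m) \<and>
        (\<forall>j. integrable (B j) (\<lambda>b. exp (\<Sum>m\<in>UNIV. b $ m * \<theta> $ m))))"

definition tilt ::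
    "('d \<Rightarrow> 'd \<Rightarrow> real \<Rightarrow> real) \<Rightarrow> real ^ 'd::finite \<Rightarrow> 'd \<Rightarrow> real ^ 'd \<Rightarrow> real" where
  "tilt g x j b = exp (\<Sum>m\<in>UNIV. b $ m * cint g m j * (x $ m - 1))"

text \<open>A solution is required to have finite expectations on both sides of the system.\<close>

definition A3_solution ::
    "('d \<Rightarrow> (real ^ 'd::finite) measure) \<Rightarrow> ('d \<Rightarrow> 'd \<Rightarrow> real \<Rightarrow> real)
      \<Rightarrow> real ^ 'd \<Rightarrow> real ^ 'd \<Rightarrow> bool" where
  "A3_solution B g r x \<longleftrightarrow>
     (\<forall>j. integrable (B j) (tilt g x j) \<and>
          (\<forall>k. integrable (B j) (\<lambda>b. b $ k * cint g k j * tilt g x j b)) \<and>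
          x $ j * (\<Sum>k\<in>UNIV. r $ k * (\<integral>b. b $ k * cint g k j * tilt g x j b \<partial>B j)) =
            r $ j * (\<integral>b. tilt g x j b \<partial>B j))"

definition A3_z ::
    "('d \<Rightarrow> (real ^ 'd::finite) measure) \<Rightarrow> ('d \<Rightarrow> 'd \<Rightarrow> real \<Rightarrow> real)
      \<Rightarrow> real ^ 'd \<Rightarrow> real ^ 'd \<Rightarrow> real ^ 'd" where
  "A3_z B g r x =
     (\<chi> j. r $ j / (\<Sum>k\<in>UNIV. r $ k * (\<integral>b. b $ k * cint g k j * tilt g x j b \<partial>B j)))"

definition mgf_vec :: "('d \<Rightarrow> (real ^ 's::finite) measure) \<Rightarrow> 'd \<Rightarrow> real ^ 's \<Rightarrow> ennreal" where
  "mgf_vec U l \<theta> = (\<integral>\<^sup>+v. ennreal (exp (\<theta> \<bullet> v)) \<partial>U l)"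

definition assumption_A3 ::
    "('d \<Rightarrow> (real ^ 'd::finite) measure) \<Rightarrow> ('d \<Rightarrow> 'd \<Rightarrow> real \<Rightarrow> real)
      \<Rightarrow> ('d \<Rightarrow> (real ^ 's::finite) measure) \<Rightarrow> bool" where
  "assumption_A3 B g U \<longleftrightarrow>
     (\<forall>r x. (\<forall>j. 0 < r $ j) \<longrightarrow> A3_solution B g r x \<longrightarrow>
        (\<exists>\<theta> :: real ^ 's. \<forall>l. mgf_vec U l \<theta> = ennreal (A3_z B g r x $ l)))"

subsection \<open>The compound process and its ruin probability\<close>

text \<open>The expectations below may be infinite, hence \<open>\<Lambda>\<close> and \<open>\<Psi>\<close> are extended real valued.\<close>

definition mgf_comp :: "('d \<Rightarrow> (real ^ 's::finite) measure) \<Rightarrow> 's \<Rightarrow> 'd \<Rightarrow> real \<Rightarrow> ennreal" where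
  "mgf_comp U i l \<theta> = (\<integral>\<^sup>+v. ennreal (exp (\<theta> * v $ i)) \<partial>U l)"

definition Lambda ::
    "'w measure \<Rightarrow> real ^ 'd::finite \<Rightarrow> ('d \<Rightarrow> (real ^ 's::finite) measure)
      \<Rightarrow> ('d event \<Rightarrow> 'd \<Rightarrow> nat \<Rightarrow> 'w \<Rightarrow> ereal) \<Rightarrow> 's \<Rightarrow> real \<Rightarrow> ereal" where
  "Lambda M base U delay i \<theta> =
     (\<Sum>j\<in>UNIV. ereal (base $ j) *
        (enn2ereal (\<integral>\<^sup>+\<omega>. (\<Prod>l\<in>UNIV. epower (mgf_comp U i l \<theta>) (cluster_size delay l j \<omega>)) \<partial>M) - 1))"

definition Psi ::
    "'w measure \<Rightarrow> real ^ 'd::finite \<Rightarrow> ('d \<Rightarrow> (real ^ 's::finite) measure)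
      \<Rightarrow> ('d event \<Rightarrow> 'd \<Rightarrow> nat \<Rightarrow> 'w \<Rightarrow> ereal) \<Rightarrow> real \<Rightarrow> 's \<Rightarrow> real \<Rightarrow> ereal" where
  "Psi M base U delay r i \<theta> = Lambda M base U delay i \<theta> - ereal (r * \<theta>)"

text \<open>
  If \<open>\<Lambda> i \<theta>\<close> is finite for some \<open>\<theta> > 0\<close>, then the integral converges for every component \<open>l\<close>
  that has events with positive probability; the other entries (0 if divergent) are
  multiplied by 0 in the net profit condition.
\<close>

definition mean_row :: "('d \<Rightarrow> (real ^ 's::finite) measure) \<Rightarrow> 's \<Rightarrow> real ^ 'd::finite" where
  "mean_row U i = (\<chi> l. \<integral>v. v $ i \<partial>U l)"

text \<open>\<open>claim j r\<close>, \<open>r = 0, 1, \<dots>\<close>, belongs to the \<open>(r+1)\<close>-st event in component \<open>j\<close>.\<close>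

definition compound ::
    "('d::finite \<Rightarrow> nat \<Rightarrow> 'w \<Rightarrow> ereal) \<Rightarrow> ('d event \<Rightarrow> 'd \<Rightarrow> nat \<Rightarrow> 'w \<Rightarrow> ereal)
      \<Rightarrow> ('d \<Rightarrow> nat \<Rightarrow> 'w \<Rightarrow> real ^ 's::finite) \<Rightarrow> 's \<Rightarrow> real \<Rightarrow> 'w \<Rightarrow> ennreal" where
  "compound imm delay claim i t \<omega> =
     (\<Sum>j\<in>UNIV. \<Sum>r. if enat r < hawkes_count imm delay j t \<omega> then ennreal (claim j r \<omega> $ i) else 0)"

definition net_process ::
    "('d::finite \<Rightarrow> nat \<Rightarrow> 'w \<Rightarrow> ereal) \<Rightarrow> ('d event \<Rightarrow> 'd \<Rightarrow> nat \<Rightarrow> 'w \<Rightarrow> ereal)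
      \<Rightarrow> ('d \<Rightarrow> nat \<Rightarrow> 'w \<Rightarrow> real ^ 's::finite) \<Rightarrow> real \<Rightarrow> 's \<Rightarrow> real \<Rightarrow> 'w \<Rightarrow> ereal" where
  "net_process imm delay claim r i t \<omega> =
     enn2ereal (compound imm delay claim i t \<omega>) - ereal (r * t)"

definition ruin_time ::
    "('d::finite \<Rightarrow> nat \<Rightarrow> 'w \<Rightarrow> ereal) \<Rightarrow> ('d event \<Rightarrow> 'd \<Rightarrow> nat \<Rightarrow> 'w \<Rightarrow> ereal)
      \<Rightarrow> ('d \<Rightarrow> nat \<Rightarrow> 'w \<Rightarrow> real ^ 's::finite) \<Rightarrow> real \<Rightarrow> 's \<Rightarrow> real \<Rightarrow> 'w \<Rightarrow> ereal" where
  "ruin_time imm delay claim r i u \<omega> =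
     Inf (ereal ` {t. 0 < t \<and> ereal u < net_process imm delay claim r i t \<omega>})"

definition ruin_probability ::
    "'w measure \<Rightarrow> ('d::finite \<Rightarrow> nat \<Rightarrow> 'w \<Rightarrow> ereal) \<Rightarrow> ('d event \<Rightarrow> 'd \<Rightarrow> nat \<Rightarrow> 'w \<Rightarrow> ereal)
      \<Rightarrow> ('d \<Rightarrow> nat \<Rightarrow> 'w \<Rightarrow> real ^ 's::finite) \<Rightarrow> real \<Rightarrow> 's \<Rightarrow> real \<Rightarrow> real" where
  "ruin_probability M imm delay claim r i u =
     measure M {\<omega>\<in>space M. ruin_time imm delay claim r i u \<omega> < \<infinity>}"

end

theory Submission
  imports Defs
begin

text \<open>
The inequality is the classical Lundberg bound for a compound Poisson process that dominates
  the compound Hawkes process. Let every event count already at the arrival time of the immigrant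
  from whose cluster it descends. The resulting vector of event numbers is at every time at least as large as
  the true one, and since claims are non-negative and attached to the rank of an event, the total
  claim amount can only increase. Clusters of distinct immigrants are independent of each other and
  of the immigration, so the enlarged event numbers have independent increments, and an increment
  over an interval of length \<open>h\<close> satisfies
  \<open>E (\<Prod>l. m\<^sub>l ^ increment\<^sub>l) \<le> exp (h * \<Lambda>)\<close>, where \<open>m\<^sub>l\<close> is the moment
  generating function of a claim and \<open>\<Lambda> = r * \<theta>\<close> by the choice of \<open>\<theta>\<close>
  (\<open>block_mgf_le\<close>). Integrating out the claims as well, \<open>exp (\<theta> * (claims - r * time))\<close> is a
  positive supermartingale along a time grid (\<open>growth_supermartingale\<close>), and the maximal
  inequality bounds by \<open>exp (- \<theta> * u)\<close> the probability that the surplus ever exceeds \<open>u\<close>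
  on the grid (\<open>discrete_lundberg\<close>).

  Everything is made discrete and finite by a truncation parameter \<open>v\<close>: clusters keep only \<open>v\<close>
  generations and delays at most \<open>v\<close>, the grid has mesh \<open>1 / (v + 1)\<close> and horizon \<open>v + 1\<close>.
  Truncated clusters are almost surely finite because a Poisson process has finitely many points in
  a bounded set. As the claim amount is non-decreasing in time, a path that is ruined in continuous
  time is ruined on every sufficiently fine truncated grid (\<open>ruin_discretised\<close>), so the bound
  survives the limit \<open>v \<longrightarrow> \<infinity>\<close>.

  The points of the Poisson processes are enumerated in an arbitrary order, which may depend on
  the whole realisation. The label of an immigrant can therefore carry information about the future,
  and only the numbers of points in disjoint sets are known to be independent. For this reason it
  is shown that the law of a truncated cluster is the same for all roots of the same component
  (\<open>distr_progeny\<close>); sums over a random set of labels then depend in law only on how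
  many labels of each component the set contains.
\<close>


section \<open>Independence and discrete random variables\<close>

instance event :: (countable) countable
  by countable_datatype

context prob_space
begin

lemma nn_integral_indep_product:
  fixes X Y :: "'a \<Rightarrow> ennreal"
  assumes "indep_var borel X borel Y"
  shows "(\<integral>\<^sup>+\<omega>. X \<omega> * Y \<omega> \<partial>M) = (\<integral>\<^sup>+\<omega>. X \<omega> \<partial>M) * (\<integral>\<^sup>+\<omega>. Y \<omega> \<partial>M)"
proof -
  have ind: "indep_vars (\<lambda>_. borel) (case_bool X Y) UNIV"
    using assms unfolding indep_var_def
    by (rule indep_vars_cong[THEN iffD1, rotated -1]) (auto split: bool.split)
  show ?thesis
    using indep_vars_nn_integral[OF _ ind] by (simp add: UNIV_bool mult.commute)
qed

text \<open>
  Integration over a discrete variable with the other source of randomness held independent: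
  \<open>R\<close> may be replaced by an independent copy. Discreteness avoids any joint measurability
  condition on \<open>h\<close>, and it suffices to have independence value by value.
\<close>
lemma nn_integral_freeze:
  fixes h :: "'c \<Rightarrow> 'a \<Rightarrow> ennreal"
  assumes C: "countable C" and R [measurable]: "R \<in> measurable M (count_space C)"
    and ind: "\<And>c. c \<in> C \<Longrightarrow> indep_var borel (\<lambda>\<omega>. indicator {c} (R \<omega>)) borel (h c)"
  shows "(\<integral>\<^sup>+\<omega>. h (R \<omega>) \<omega> \<partial>M) = (\<integral>\<^sup>+\<omega>'. \<integral>\<^sup>+\<omega>. h (R \<omega>') \<omega> \<partial>M \<partial>M)"
proof -
  have h [measurable]: "h c \<in> borel_measurable M" if "c \<in> C" for c
    using ind[OF that] by (rule indep_var_rv2)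
  have i [measurable]: "(\<lambda>\<omega>. indicator {c} (R \<omega>) :: ennreal) \<in> borel_measurable M" if "c \<in> C" for c
    using ind[OF that] by (rule indep_var_rv1)
  have expand: "(\<integral>\<^sup>+c. f c * indicator {c} (R \<omega>) \<partial>count_space C) = f (R \<omega>)"
    if "\<omega> \<in> space M" for f :: "'c \<Rightarrow> ennreal" and \<omega>
  proof -
    have "R \<omega> \<in> C" using measurable_space[OF R that] by simp
    moreover have "(\<integral>\<^sup>+c. f c * indicator {c} (R \<omega>) \<partial>count_space C)
        = (\<integral>\<^sup>+c. f c * indicator {R \<omega>} c \<partial>count_space C)"
      by (intro nn_integral_cong) (auto split: split_indicator)
    ultimately show ?thesis by simp
  qed
  have "(\<integral>\<^sup>+\<omega>. h (R \<omega>) \<omega> \<partial>M)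
      = (\<integral>\<^sup>+\<omega>. \<integral>\<^sup>+c. h c \<omega> * indicator {c} (R \<omega>) \<partial>count_space C \<partial>M)"
    using expand by (intro nn_integral_cong) simp
  also have "\<dots> = (\<integral>\<^sup>+c. \<integral>\<^sup>+\<omega>. h c \<omega> * indicator {c} (R \<omega>) \<partial>M \<partial>count_space C)"
    using C h i by (intro nn_integral_count_space_nn_integral borel_measurable_times) auto
  also have "\<dots> = (\<integral>\<^sup>+c. \<integral>\<^sup>+\<omega>'. (\<integral>\<^sup>+\<omega>. h c \<omega> \<partial>M) * indicator {c} (R \<omega>') \<partial>M \<partial>count_space C)"
  proof (rule nn_integral_cong)
    fix c assume "c \<in> space (count_space C)"
    then have c: "c \<in> C" by simp
    have "(\<integral>\<^sup>+\<omega>. h c \<omega> * indicator {c} (R \<omega>) \<partial>M)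
        = (\<integral>\<^sup>+\<omega>. indicator {c} (R \<omega>) \<partial>M) * (\<integral>\<^sup>+\<omega>. h c \<omega> \<partial>M)"
      using nn_integral_indep_product[OF ind[OF c]] by (simp add: mult.commute)
    also have "\<dots> = (\<integral>\<^sup>+\<omega>'. (\<integral>\<^sup>+\<omega>. h c \<omega> \<partial>M) * indicator {c} (R \<omega>') \<partial>M)"
      using i[OF c] by (subst nn_integral_cmult) (auto simp: mult.commute)
    finally show "(\<integral>\<^sup>+\<omega>. h c \<omega> * indicator {c} (R \<omega>) \<partial>M) = \<dots>" .
  qed
  also have "\<dots> = (\<integral>\<^sup>+\<omega>'. \<integral>\<^sup>+c. (\<integral>\<^sup>+\<omega>. h c \<omega> \<partial>M) * indicator {c} (R \<omega>') \<partial>count_space C \<partial>M)"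
    using C i by (intro nn_integral_count_space_nn_integral[symmetric] borel_measurable_times) auto
  also have "\<dots> = (\<integral>\<^sup>+\<omega>'. \<integral>\<^sup>+\<omega>. h (R \<omega>') \<omega> \<partial>M \<partial>M)"
    using expand by (intro nn_integral_cong) simp
  finally show ?thesis .
qed

text \<open>
  An independent family has the product of its marginals as joint law, so equal marginals give
  equal expectations of every functional of the family.
\<close>
lemma nn_integral_family_eq:
  assumes X: "indep_vars (\<lambda>_. N) X J" and Y: "indep_vars (\<lambda>_. N) Y J"
    and law: "\<And>q. q \<in> J \<Longrightarrow> distr M N (X q) = distr M N (Y q)"
    and F: "F \<in> borel_measurable (\<Pi>\<^sub>M q\<in>J. N)"
  shows "(\<integral>\<^sup>+\<omega>. F (\<lambda>q\<in>J. X q \<omega>) \<partial>M) = (\<integral>\<^sup>+\<omega>. F (\<lambda>q\<in>J. Y q \<omega>) \<partial>M)"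
proof (cases "J = {}")
  case False
  have rX: "X q \<in> measurable M N" and rY: "Y q \<in> measurable M N" if "q \<in> J" for q
    using X Y that by (auto simp: indep_vars_def)
  have "distr M (\<Pi>\<^sub>M q\<in>J. N) (\<lambda>\<omega>. \<lambda>q\<in>J. X q \<omega>) = (\<Pi>\<^sub>M q\<in>J. distr M N (X q))"
    using X rX False by (subst (asm) indep_vars_iff_distr_eq_PiM') auto
  also have "\<dots> = (\<Pi>\<^sub>M q\<in>J. distr M N (Y q))"
    by (intro PiM_cong law) auto
  also have "\<dots> = distr M (\<Pi>\<^sub>M q\<in>J. N) (\<lambda>\<omega>. \<lambda>q\<in>J. Y q \<omega>)"
    using Y rY False by (subst (asm) indep_vars_iff_distr_eq_PiM') auto
  finally have eq: "distr M (\<Pi>\<^sub>M q\<in>J. N) (\<lambda>\<omega>. \<lambda>q\<in>J. X q \<omega>)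
    = distr M (\<Pi>\<^sub>M q\<in>J. N) (\<lambda>\<omega>. \<lambda>q\<in>J. Y q \<omega>)" .
  have "(\<integral>\<^sup>+\<omega>. F (\<lambda>q\<in>J. X q \<omega>) \<partial>M)
      = (\<integral>\<^sup>+z. F z \<partial>distr M (\<Pi>\<^sub>M q\<in>J. N) (\<lambda>\<omega>. \<lambda>q\<in>J. X q \<omega>))"
    by (subst nn_integral_distr) (auto intro!: measurable_restrict rX F)
  also have "\<dots> = (\<integral>\<^sup>+\<omega>. F (\<lambda>q\<in>J. Y q \<omega>) \<partial>M)"
    unfolding eq by (subst nn_integral_distr) (auto intro!: measurable_restrict rY F)
  finally show ?thesis .
qed (simp add: restrict_def)

end

lemma measurable_PiM_sum_count_space:
  assumes "finite K" "K \<subseteq> J"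
  shows "(\<lambda>x. \<Sum>q\<in>K. x q) \<in> measurable (\<Pi>\<^sub>M q\<in>J. count_space UNIV)
    (count_space (UNIV :: 'a :: {countable, comm_monoid_add} set))"
  using assms
proof (induction K)
  case (insert q K)
  have "(\<lambda>x. x q + s) \<in> measurable (\<Pi>\<^sub>M q\<in>J. count_space UNIV) (count_space (UNIV :: 'a set))" for s
    using insert.prems by (intro measurable_compose[OF measurable_component_singleton]) auto
  moreover have "(\<lambda>x. sum x K)
      \<in> measurable (\<Pi>\<^sub>M q\<in>J. count_space UNIV) (count_space (UNIV :: 'a set))"
    using insert by auto
  ultimately have "(\<lambda>x. x q + sum x K)
      \<in> measurable (\<Pi>\<^sub>M q\<in>J. count_space UNIV) (count_space (UNIV :: 'a set))"
    by (rule measurable_compose_countable)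
  then show ?case using insert.hyps by simp
qed simp

lemma (in prob_space) nn_integral_sum_family_eq:
  fixes X :: "'q \<Rightarrow> 'a \<Rightarrow> 'b :: {countable, comm_monoid_add}"
  assumes J: "finite J"
    and X: "indep_vars (\<lambda>_. count_space UNIV) X J" 
    and Y: "indep_vars (\<lambda>_. count_space UNIV) Y J"
    and law: "\<And>q. q \<in> J \<Longrightarrow> distr M (count_space UNIV) (X q) = distr M (count_space UNIV) (Y q)"
  shows "(\<integral>\<^sup>+\<omega>. f (\<Sum>q\<in>J. X q \<omega>) \<partial>M) = (\<integral>\<^sup>+\<omega>. f (\<Sum>q\<in>J. Y q \<omega>) \<partial>M)"
proof -
  have "(\<lambda>x. f (\<Sum>q\<in>J. x q)) \<in> borel_measurable (\<Pi>\<^sub>M q\<in>J. count_space (UNIV :: 'b set))"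
    by (rule measurable_compose[OF measurable_PiM_sum_count_space[OF J order_refl]]) simp
  from nn_integral_family_eq[OF X Y law this] show ?thesis by simp
qed

text \<open>
  Only countably many sets of labels are finite. Mapping infinite sets to the empty one makes a random
  set of labels a discrete random variable, and sums over the set do not notice the change.
\<close>
definition fin_part :: "'q set \<Rightarrow> 'q set" where
  "fin_part R = (if finite R then R else {})"

lemma finite_fin_part [simp]: "finite (fin_part R)"
  by (simp add: fin_part_def)

lemma sum_fin_part [simp]: "sum f (fin_part R) = sum f R"
  by (simp add: fin_part_def)

lemma countable_finite_sets: "countable (Collect finite :: 'q :: countable set set)"
  using countable_Collect_finite_subset[of "UNIV :: 'q set"] by simp


lemma measurable_fin_part:
  fixes R :: "'w \<Rightarrow> 'q :: countable set"
  assumes "\<And>p. {\<omega>\<in>space M. p \<in> R \<omega>} \<in> sets M"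
  shows "(\<lambda>\<omega>. fin_part (R \<omega>)) \<in> measurable M (count_space (Collect finite))"
proof (subst measurable_count_space_eq_countable)
  have [measurable]: "Measurable.pred M (\<lambda>\<omega>. p \<in> R \<omega>)" for p
    using assms by (simp add: pred_def)
  show "countable (Collect finite :: 'q set set)"
    by (rule countable_finite_sets)
  have eq: "{\<omega>\<in>space M. R \<omega> = A} \<in> sets M" for A
  proof -
    have "{\<omega>\<in>space M. R \<omega> = A} = {\<omega>\<in>space M. \<forall>p. p \<in> R \<omega> \<longleftrightarrow> p \<in> A}" by auto
    also have "\<dots> \<in> sets M" by measurable
    finally show ?thesis .
  qed
  have fin: "{\<omega>\<in>space M. finite (R \<omega>)} \<in> sets M"
  proof -
    have "{\<omega>\<in>space M. finite (R \<omega>)} = (\<Union>A\<in>Collect finite. {\<omega>\<in>space M. R \<omega> = A})" by auto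
    also have "\<dots> \<in> sets M"
      using countable_Collect_finite_subset[of "UNIV :: 'q set"] eq
      by (intro sets.countable_UN') auto
    finally show ?thesis .
  qed
  have "(\<lambda>\<omega>. fin_part (R \<omega>)) -` {A} \<inter> space M \<in> sets M" if "finite A" for A
  proof -
    have "fin_part S = A \<longleftrightarrow> S = A \<or> A = {} \<and> infinite S" for S
      using that by (auto simp: fin_part_def)
    then have "(\<lambda>\<omega>. fin_part (R \<omega>)) -` {A} \<inter> space M = {\<omega>\<in>space M. R \<omega> = A} \<union>
        (if A = {} then space M - {\<omega>\<in>space M. finite (R \<omega>)} else {})"
      by auto
    then show ?thesis using eq fin by auto
  qed
  then show "(\<lambda>\<omega>. fin_part (R \<omega>)) \<in> space M \<rightarrow> Collect finite \<and>
    (\<forall>a\<in>Collect finite. (\<lambda>\<omega>. fin_part (R \<omega>)) -` {a} \<inter> space M \<in> sets M)"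
    by auto
qed

section \<open>Counting points of Poisson processes\<close>

definition points :: "('d \<Rightarrow> nat \<Rightarrow> 'w \<Rightarrow> ereal) \<Rightarrow> real set \<Rightarrow> 'w \<Rightarrow> ('d \<times> nat) set" where
  "points T A \<omega> = {(m, k). T m k \<omega> \<in> ereal ` A}"

definition counts :: "('d \<times> nat) set \<Rightarrow> 'd \<Rightarrow> nat" where
  "counts R m = card {k. (m, k) \<in> R}"

lemma npoints_eq_iff:
  fixes T :: "'d::finite \<Rightarrow> nat \<Rightarrow> 'w \<Rightarrow> ereal"
  shows "(\<forall>m. npoints (\<lambda>k. T m k \<omega>) A = enat (\<kappa> m)) \<longleftrightarrow>
    finite (points T A \<omega>) \<and> counts (points T A \<omega>) = \<kappa>"
proof -
  have "points T A \<omega> = Sigma UNIV (\<lambda>m. {k. T m k \<omega> \<in> ereal ` A})"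
    by (auto simp: points_def)
  moreover have "{k. T m k \<omega> \<in> ereal ` A} \<subseteq> snd ` points T A \<omega>" for m
    by (force simp: points_def)
  then have "finite (points T A \<omega>) \<Longrightarrow> finite {k. T m k \<omega> \<in> ereal ` A}" for m
    by (rule finite_subset) simp
  ultimately have "finite (points T A \<omega>) \<longleftrightarrow> (\<forall>m. finite {k. T m k \<omega> \<in> ereal ` A})"
    by auto
  then show ?thesis
    by (auto simp: npoints_def ecount_def counts_def points_def fun_eq_iff)
qed

lemma ereal_image_iff: "x \<in> ereal ` A \<longleftrightarrow> \<bar>x\<bar> \<noteq> \<infinity> \<and> real_of_ereal x \<in> A"
  by (cases x) auto

lemma sets_points:
  assumes "\<And>m k. T m k \<in> borel_measurable M" "A \<in> sets borel"
  shows "{\<omega>\<in>space M. p \<in> points T A \<omega>} \<in> sets M"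
proof -
  have [measurable]: "T m k \<in> borel_measurable M" "A \<in> sets borel" for m k
    using assms by auto
  show ?thesis
    unfolding points_def by (cases p) (simp add: ereal_image_iff)
qed

text \<open>
  Fubini for the counting measure on vectors of numbers, seen as a finite product of counting
  measures.
\<close>
lemma nn_integral_count_prod:
  fixes f :: "'d::finite \<Rightarrow> nat \<Rightarrow> ennreal"
  shows "(\<integral>\<^sup>+\<kappa>. (\<Prod>m\<in>UNIV. f m (\<kappa> m)) \<partial>count_space UNIV)
    = (\<Prod>m\<in>UNIV. \<integral>\<^sup>+k. f m k \<partial>count_space UNIV)"
proof -
  interpret product_sigma_finite "\<lambda>_::'d. count_space (UNIV :: nat set)"
    unfolding product_sigma_finite_def
    by (simp add: sigma_finite_measure_count_space_countable)
  have "(\<Pi>\<^sub>M m\<in>UNIV::'d set. count_space (UNIV :: nat set)) = count_space UNIV"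
    by (subst count_space_PiM_finite) (auto simp: PiE_def)
  then show ?thesis
    using product_nn_integral_prod[of UNIV f] by simp
qed

lemma poisson_weight_nonneg: "0 \<le> \<mu> \<Longrightarrow> 0 \<le> poisson_weight \<mu> k"
  by (simp add: poisson_weight_def)

lemma poisson_weight_sums:
  "(\<lambda>k. poisson_weight \<mu> k * x ^ k) sums exp (\<mu> * (x - 1))"
proof -
  have "(\<lambda>k. exp (- \<mu>) * ((\<mu> * x) ^ k /\<^sub>R fact k)) sums (exp (- \<mu>) * exp (\<mu> * x))"
    by (intro sums_mult exp_converges)
  then show ?thesis
    by (simp add: poisson_weight_def power_mult_distrib field_simps flip: exp_add)
qed

lemma poisson_weight_le_1:
  assumes "0 \<le> \<mu>" shows "poisson_weight \<mu> k \<le> 1"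
proof -
  have "(\<lambda>k. poisson_weight \<mu> k) sums 1"
    using poisson_weight_sums[of \<mu> 1] by simp
  then have "sum (poisson_weight \<mu>) {k} \<le> 1"
    using assms by (metis (no_types, lifting) poisson_weight_nonneg sum_le_suminf sums_iff finite.intros)
  then show ?thesis by simp
qed

lemma poisson_transform:
  assumes "0 \<le> \<mu>" "0 \<le> x"
  shows "(\<integral>\<^sup>+k. ennreal (poisson_weight \<mu> k) * ennreal x ^ k \<partial>count_space UNIV)
    = ennreal (exp (\<mu> * (x - 1)))"
proof -
  have "(\<integral>\<^sup>+k. ennreal (poisson_weight \<mu> k) * ennreal x ^ k \<partial>count_space UNIV)
      = (\<Sum>k. ennreal (poisson_weight \<mu> k * x ^ k))"
    using assms by (simp add: nn_integral_count_space_nat ennreal_mult ennreal_power poisson_weight_nonneg)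
  also have "\<dots> = ennreal (exp (\<mu> * (x - 1)))"
    using assms poisson_weight_sums[of \<mu> x]
    by (intro suminf_ennreal_eq) (auto simp: poisson_weight_nonneg)
  finally show ?thesis .
qed

text \<open>
  A separate statement because here \<open>z\<close> may be infinite: a component without immigration
  contributes the factor 1 even if its clusters have infinite exponential moments.
\<close>
lemma poisson_transform_0:
  "(\<integral>\<^sup>+k. ennreal (poisson_weight 0 k) * z ^ k \<partial>count_space UNIV) = 1"
proof -
  have "(\<Sum>k. ennreal (poisson_weight 0 k) * z ^ k) = (\<Sum>k\<in>{0}. ennreal (poisson_weight 0 k) * z ^ k)"
    by (rule suminf_finite) (auto simp: poisson_weight_def)
  then show ?thesis by (simp add: nn_integral_count_space_nat poisson_weight_def)
qed

context prob_space
begin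

lemma cond_poisson_single:
  fixes T :: "'d::finite \<Rightarrow> nat \<Rightarrow> 'a \<Rightarrow> ereal"
  assumes T: "cond_poisson_process M N X \<phi> T"
    and A: "A \<in> sets borel" "bounded A" "A \<subseteq> {0<..}"
  shows "prob {\<omega>\<in>space M. finite (points T A \<omega>) \<and> counts (points T A \<omega>) = \<kappa>}
    = (\<integral>\<omega>. (\<Prod>m\<in>UNIV. poisson_weight (LBINT s:A. \<phi> (X \<omega>) m s) (\<kappa> m)) \<partial>M)"
proof -
  have X: "X \<in> measurable M N" using T by (simp add: cond_poisson_process_def)
  have "prob {\<omega>\<in>space M. X \<omega> \<in> space N \<and> (\<forall>i<1::nat. \<forall>m. npoints (\<lambda>k. T m k \<omega>) A = enat (\<kappa> m))}
    = (\<integral>\<omega>. indicator (space N) (X \<omega>) *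
       (\<Prod>i<1::nat. \<Prod>m\<in>UNIV. poisson_weight (LBINT s:A. \<phi> (X \<omega>) m s) (\<kappa> m)) \<partial>M)"
    using A by (intro T[unfolded cond_poisson_process_def, THEN conjunct2, THEN conjunct2, rule_format,
      of "space N" 1 "\<lambda>_. A" "\<lambda>_. \<kappa>"]) (auto simp: disjoint_family_on_def)
  moreover have "{\<omega>\<in>space M. X \<omega> \<in> space N \<and> (\<forall>i<1::nat. \<forall>m. npoints (\<lambda>k. T m k \<omega>) A = enat (\<kappa> m))}
    = {\<omega>\<in>space M. finite (points T A \<omega>) \<and> counts (points T A \<omega>) = \<kappa>}"
    using measurable_space[OF X] by (auto simp: npoints_eq_iff)
  moreover have "(\<integral>\<omega>. indicator (space N) (X \<omega>) *
       (\<Prod>i<1::nat. \<Prod>m\<in>UNIV. poisson_weight (LBINT s:A. \<phi> (X \<omega>) m s) (\<kappa> m)) \<partial>M)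
    = (\<integral>\<omega>. (\<Prod>m\<in>UNIV. poisson_weight (LBINT s:A. \<phi> (X \<omega>) m s) (\<kappa> m)) \<partial>M)"
    using measurable_space[OF X] by (intro Bochner_Integration.integral_cong) auto
  ultimately show ?thesis by simp
qed

lemma sets_points_event:
  fixes T :: "'d::finite \<Rightarrow> nat \<Rightarrow> 'a \<Rightarrow> ereal"
  assumes "\<And>m k. T m k \<in> borel_measurable M" "A \<in> sets borel"
  shows "{\<omega>\<in>space M. finite (points T A \<omega>) \<and> P (points T A \<omega>)} \<in> events"
proof -
  have m: "{\<omega>\<in>space M. points T A \<omega> = R} \<in> events" for R
  proof -
    have [measurable]: "Measurable.pred M (\<lambda>\<omega>. p \<in> points T A \<omega>)" for p
      using sets_points[OF assms] by (simp add: pred_def)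
    have "{\<omega>\<in>space M. points T A \<omega> = R} = {\<omega>\<in>space M. \<forall>p. p \<in> points T A \<omega> \<longleftrightarrow> p \<in> R}" by auto
    also have "\<dots> \<in> events" by measurable
    finally show ?thesis .
  qed
  have "{\<omega>\<in>space M. finite (points T A \<omega>) \<and> P (points T A \<omega>)}
    = (\<Union>R\<in>{R. finite R \<and> P R}. {\<omega>\<in>space M. points T A \<omega> = R})" by auto
  also have "\<dots> \<in> events"
    using m countable_subset[OF _ countable_finite_sets, of "{R. finite R \<and> P R}"]
    by (intro sets.countable_UN') auto
  finally show ?thesis .
qed

text \<open>
  The probabilities of finite counts, being mixtures of products of Poisson weights, sum to 1; thus
  no mass is left for infinitely many points.
\<close>
lemma AE_finite_points:
  fixes T :: "'d::finite \<Rightarrow> nat \<Rightarrow> 'a \<Rightarrow> ereal"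
  assumes T: "cond_poisson_process M N X \<phi> T"
    and A: "A \<in> sets borel" "bounded A" "A \<subseteq> {0<..}"
    and meas [measurable]: "\<And>m. (\<lambda>\<omega>. LBINT s:A. \<phi> (X \<omega>) m s) \<in> borel_measurable M"
    and nonneg: "AE \<omega> in M. \<forall>m. 0 \<le> (LBINT s:A. \<phi> (X \<omega>) m s)"
  shows "AE \<omega> in M. finite (points T A \<omega>)"
proof -
  define \<mu> where "\<mu> \<omega> m = (LBINT s:A. \<phi> (X \<omega>) m s)" for \<omega> m
  have [measurable]: "(\<lambda>\<omega>. \<mu> \<omega> m) \<in> borel_measurable M" for m
    unfolding \<mu>_def by simp
  have [measurable]: "(\<lambda>\<omega>. poisson_weight (\<mu> \<omega> m) k) \<in> borel_measurable M" for m k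
    unfolding poisson_weight_def by measurable
  define E where "E \<kappa> = {\<omega>\<in>space M. finite (points T A \<omega>) \<and> counts (points T A \<omega>) = \<kappa>}" for \<kappa>
  have T_meas: "T m k \<in> borel_measurable M" for m k
    using T by (simp add: cond_poisson_process_def)
  have E: "E \<kappa> \<in> events" for \<kappa>
    unfolding E_def using T_meas A(1) by (rule sets_points_event)
  have pE: "emeasure M (E \<kappa>) = (\<integral>\<^sup>+\<omega>. (\<Prod>m\<in>UNIV. ennreal (poisson_weight (\<mu> \<omega> m) (\<kappa> m))) \<partial>M)" for \<kappa>
  proof -
    have le1: "AE \<omega> in M. norm (\<Prod>m\<in>UNIV. poisson_weight (\<mu> \<omega> m) (\<kappa> m)) \<le> 1"
      using nonneg unfolding \<mu>_def[symmetric]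
      by eventually_elim
         (auto simp: prod_nonneg poisson_weight_nonneg poisson_weight_le_1 intro!: prod_le_1)
    have "emeasure M (E \<kappa>) = ennreal (\<integral>\<omega>. (\<Prod>m\<in>UNIV. poisson_weight (\<mu> \<omega> m) (\<kappa> m)) \<partial>M)"
      using cond_poisson_single[OF T A, of \<kappa>] by (simp add: emeasure_eq_measure E_def \<mu>_def)
    also have "\<dots> = (\<integral>\<^sup>+\<omega>. ennreal (\<Prod>m\<in>UNIV. poisson_weight (\<mu> \<omega> m) (\<kappa> m)) \<partial>M)"
      using nonneg unfolding \<mu>_def[symmetric]
      by (intro nn_integral_eq_integral[symmetric] integrable_const_bound[OF le1])
         (auto elim!: eventually_mono intro!: prod_nonneg poisson_weight_nonneg)
    also have "\<dots> = (\<integral>\<^sup>+\<omega>. (\<Prod>m\<in>UNIV. ennreal (poisson_weight (\<mu> \<omega> m) (\<kappa> m))) \<partial>M)"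
      using nonneg unfolding \<mu>_def[symmetric]
      by (intro nn_integral_cong_AE) (auto elim!: eventually_mono simp: prod_ennreal poisson_weight_nonneg)
    finally show ?thesis .
  qed
  have "emeasure M (\<Union>\<kappa>. E \<kappa>) = (\<integral>\<^sup>+\<kappa>. emeasure M (E \<kappa>) \<partial>count_space UNIV)"
    using E by (intro emeasure_UN_countable) (auto simp: disjoint_family_on_def E_def)
  also have "\<dots> = (\<integral>\<^sup>+\<omega>. \<integral>\<^sup>+\<kappa>. (\<Prod>m\<in>UNIV. ennreal (poisson_weight (\<mu> \<omega> m) (\<kappa> m))) \<partial>count_space UNIV \<partial>M)"
    unfolding pE by (rule nn_integral_count_space_nn_integral[symmetric]) auto
  also have "\<dots> = (\<integral>\<^sup>+\<omega>. 1 \<partial>M)"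
  proof (rule nn_integral_cong_AE)
    show "AE \<omega> in M. (\<integral>\<^sup>+\<kappa>. (\<Prod>m\<in>UNIV. ennreal (poisson_weight (\<mu> \<omega> m) (\<kappa> m))) \<partial>count_space UNIV) = 1"
      using nonneg unfolding \<mu>_def[symmetric]
    proof eventually_elim
      case (elim \<omega>)
      then show ?case
        using poisson_transform[where x=1]
        by (subst nn_integral_count_prod[where f="\<lambda>m k. ennreal (poisson_weight (\<mu> \<omega> m) k)"]) simp
    qed
  qed
  also have "\<dots> = 1" by (simp add: emeasure_space_1)
  finally have "prob (\<Union>\<kappa>. E \<kappa>) = 1" by (simp add: emeasure_eq_measure)
  then have "AE \<omega> in M. \<omega> \<in> (\<Union>\<kappa>. E \<kappa>)"
    using E by (subst (asm) prob_eq_1) auto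
  then show ?thesis by eventually_elim (auto simp: E_def)
qed

end


section \<open>Label sets and lines of descent\<close>

lemma borel_measurable_vec_nth [measurable]: "(\<lambda>v::real^'n. v $ i) \<in> borel_measurable borel"
  by (intro borel_measurable_continuous_onI continuous_intros)

lemma counts_eq_bij:
  assumes "finite R" "finite R'" "counts R = counts R'"
  obtains \<beta> where "bij_betw \<beta> R R'" "\<And>p. p \<in> R \<Longrightarrow> fst (\<beta> p) = fst p"
proof -
  have fin: "finite {k. (m, k) \<in> R}" if "finite R" for m and R :: "('a \<times> nat) set"
    using finite_imageI[OF that, of snd] by (rule finite_subset[rotated]) force
  have "\<exists>b. bij_betw b {k. (m, k) \<in> R} {k. (m, k) \<in> R'}" for m
    using assms(3) by (intro finite_same_card_bij fin assms) (auto simp: counts_def dest: fun_cong)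
  then obtain b where b: "bij_betw (b m) {k. (m, k) \<in> R} {k. (m, k) \<in> R'}" for m by metis
  show thesis
  proof
    show "bij_betw (\<lambda>(m, k). (m, b m k)) R R'"
    proof (intro bij_betw_imageI)
      show "inj_on (\<lambda>(m, k). (m, b m k)) R"
        using b by (auto simp: inj_on_def bij_betw_def)
      show "(\<lambda>(m, k). (m, b m k)) ` R = R'"
      proof safe
        fix m k assume "(m, k) \<in> R" then show "(m, b m k) \<in> R'"
          using b[of m] by (auto simp: bij_betw_def)
      next
        fix m k assume "(m, k) \<in> R'"
        then have "k \<in> b m ` {k. (m, k) \<in> R}" using b[of m] by (auto simp: bij_betw_def)
        then show "(m, k) \<in> (\<lambda>(m, k). (m, b m k)) ` R" by force
      qed
    qed
  qed auto
qed

lemma (in prob_space) indep_vars_reindex_bij: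
  assumes X: "indep_vars (\<lambda>_. N) X (\<beta> ` J)" and inj: "inj_on \<beta> J"
  shows "indep_vars (\<lambda>_. N) (\<lambda>q. X (\<beta> q)) J"
  unfolding indep_vars_def
proof (intro conjI ballI indep_setsI)
  show "random_variable N (X (\<beta> q))" if "q \<in> J" for q
    using X that by (auto simp: indep_vars_def)
  then show "sigma_sets (space M) {X (\<beta> q) -` A \<inter> space M |A. A \<in> sets N} \<subseteq> events" if "q \<in> J" for q
    using that by (intro sets.sigma_sets_subset) (auto intro: measurable_sets)
next
  fix A K assume K: "K \<noteq> {}" "K \<subseteq> J" "finite K"
    and A: "\<forall>q\<in>K. A q \<in> sigma_sets (space M) {X (\<beta> q) -` A \<inter> space M |A. A \<in> sets N}"
  have inv: "the_inv_into J \<beta> (\<beta> q) = q" if "q \<in> K" for q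
    using that K inj by (intro the_inv_into_f_f) auto
  have ind: "indep_sets (\<lambda>q. sigma_sets (space M) {X q -` A \<inter> space M |A. A \<in> sets N}) (\<beta> ` J)"
    using X by (simp add: indep_vars_def)
  have mem: "\<forall>p\<in>\<beta> ` K. A (the_inv_into J \<beta> p)
      \<in> sigma_sets (space M) {X p -` A \<inter> space M |A. A \<in> sets N}"
  proof safe
    fix q assume "q \<in> K"
    then show "A (the_inv_into J \<beta> (\<beta> q)) \<in> sigma_sets (space M) {X (\<beta> q) -` A \<inter> space M |A. A \<in> sets N}"
      unfolding inv[OF \<open>q \<in> K\<close>] by (rule A[rule_format])
  qed
  have sub: "\<beta> ` K \<subseteq> \<beta> ` J" and ne: "\<beta> ` K \<noteq> {}" and fin: "finite (\<beta> ` K)"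
    using K by (simp_all add: image_mono)
  have "prob (\<Inter>p\<in>\<beta> ` K. A (the_inv_into J \<beta> p)) = (\<Prod>p\<in>\<beta> ` K. prob (A (the_inv_into J \<beta> p)))"
    by (rule indep_setsD[OF ind sub ne fin mem])
  then show "prob (\<Inter> (A ` K)) = (\<Prod>q\<in>K. prob (A q))"
    using inv inj_on_subset[OF inj K(2)] by (simp add: prod.reindex image_image)
qed

text \<open>
  The sum of independent vectors over a set of labels depends in law only on the numbers of labels of
  each component if the law of a summand depends only on the component: a bijection between label
  sets that respects components reduces the claim to equality of marginals.
\<close>
lemma (in prob_space) nn_integral_sum_counts_eq:
  fixes X Y :: "'d \<times> nat \<Rightarrow> 'a \<Rightarrow> 'b :: {countable, comm_monoid_add}"
  assumes fin: "finite R" "finite R'" and cnt: "counts R = counts R'"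
    and X: "indep_vars (\<lambda>_. count_space UNIV) X R"
    and Y: "indep_vars (\<lambda>_. count_space UNIV) Y R'"
    and law: "\<And>p q. p \<in> R \<Longrightarrow> q \<in> R' \<Longrightarrow> fst p = fst q \<Longrightarrow>
      distr M (count_space UNIV) (X p) = distr M (count_space UNIV) (Y q)"
  shows "(\<integral>\<^sup>+\<omega>. f (\<Sum>p\<in>R. X p \<omega>) \<partial>M) = (\<integral>\<^sup>+\<omega>. f (\<Sum>p\<in>R'. Y p \<omega>) \<partial>M)"
proof -
  obtain \<beta> where \<beta>: "bij_betw \<beta> R R'" "\<And>p. p \<in> R \<Longrightarrow> fst (\<beta> p) = fst p"
    using counts_eq_bij[OF fin cnt] by blast
  have Y': "indep_vars (\<lambda>_. count_space UNIV) (\<lambda>p. Y (\<beta> p)) R"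
    using Y bij_betw_imp_inj_on[OF \<beta>(1)] unfolding bij_betw_imp_surj_on[OF \<beta>(1), symmetric]
    by (rule indep_vars_reindex_bij)
  have "(\<integral>\<^sup>+\<omega>. f (\<Sum>p\<in>R. X p \<omega>) \<partial>M) = (\<integral>\<^sup>+\<omega>. f (\<Sum>p\<in>R. Y (\<beta> p) \<omega>) \<partial>M)"
    by (rule nn_integral_sum_family_eq[OF fin(1) X Y'])
       (rule law; simp add: \<beta>(2) bij_betwE[OF \<beta>(1), rule_format])
  also have "\<dots> = (\<integral>\<^sup>+\<omega>. f (\<Sum>p\<in>R'. Y p \<omega>) \<partial>M)"
    by (intro nn_integral_cong arg_cong[where f=f] sum.reindex_bij_betw[OF \<beta>(1)])
  finally show ?thesis .
qed

fun progenitor :: "'d event \<Rightarrow> 'd event \<Rightarrow> bool" where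
  "progenitor e (Immigrant j k) \<longleftrightarrow> e = Immigrant j k"
| "progenitor e (Offspring f m k) \<longleftrightarrow> e = Offspring f m k \<or> progenitor e f"

lemma progenitor_refl [simp]: "progenitor e e"
  by (cases e) auto

lemma progenitor_size: "progenitor e f \<Longrightarrow> size e \<le> size f"
  by (induction f) auto

lemma progenitor_child: "progenitor (Offspring e m k) f \<Longrightarrow> progenitor e f"
  by (induction f) auto

lemma not_progenitor_parent [simp]: "\<not> progenitor (Offspring e m k) e"
  using progenitor_size[of "Offspring e m k" e] by auto

lemma progenitor_siblings: "progenitor (Offspring e m k) f \<Longrightarrow> progenitor (Offspring e m' k') f \<Longrightarrow> m = m' \<and> k = k'"
  by (induction f) auto

lemma progenitor_ancestor: "progenitor e f \<Longrightarrow> ancestor f = ancestor e"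
  by (induction f) auto

section \<open>The sources of randomness\<close>

context compound_hawkes
begin

text \<open>
  All sources of randomness are given the same type so that they form one independent family. The
  mark of an event enters through the delays of its children.
\<close>
definition signal :: "'s \<Rightarrow> 'd source \<Rightarrow> 'w \<Rightarrow> 'd \<times> nat \<Rightarrow> ereal" where
  "signal i x \<omega> = (case x of
      Immigration \<Rightarrow> (\<lambda>(j, k). imm j k \<omega>)
    | Reproduction e \<Rightarrow> (\<lambda>(m, k). delay e m k \<omega>)
    | Claim j r \<Rightarrow> (\<lambda>_. ereal (claim j r \<omega> $ i)))"

abbreviation signal_space :: "('d \<times> nat \<Rightarrow> ereal) measure" where
  "signal_space \<equiv> \<Pi>\<^sub>M p\<in>UNIV. borel"

lemma measurable_imm [measurable]: "imm j k \<in> borel_measurable M"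
  and imm_pos: "\<omega> \<in> space M \<Longrightarrow> 0 < imm j k \<omega>"
  using immigration by (auto simp: poisson_process_def cond_poisson_process_def)

lemma measurable_delay [measurable]: "delay e m k \<in> borel_measurable M"
  and delay_pos: "\<omega> \<in> space M \<Longrightarrow> 0 < delay e m k \<omega>"
  and measurable_mark [measurable]: "mark e \<in> borel_measurable M"
  using reproduction[of e] by (auto simp: cond_poisson_process_def)

lemma measurable_claim [measurable]: "claim j r \<in> borel_measurable M"
  by (rule claim_measurable)

lemma measurable_signal: "signal i x \<in> measurable M signal_space"
proof (rule measurable_PiM_single')
  show "(\<lambda>\<omega>. signal i x \<omega> p) \<in> borel_measurable M" for p
    by (cases p; cases x) (auto simp: signal_def intro: measurable_compose[OF _ borel_measurable_vec_nth])
qed auto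

lemma indep_vars_signal: "indep_vars (\<lambda>_. signal_space) (signal i) UNIV"
  unfolding indep_vars_def2
proof (intro conjI ballI measurable_signal indep_sets_mono_sets[OF independent])
  fix x :: "'d source"
  show "{signal i x -` A \<inter> space M |A. A \<in> sets signal_space} \<subseteq> (case x of
      Immigration \<Rightarrow> sets (vimage_algebra (space M) (\<lambda>\<omega>. \<lambda>(j, k). imm j k \<omega>) signal_space)
    | Reproduction e \<Rightarrow> sets (vimage_algebra (space M) (\<lambda>\<omega>. (mark e \<omega>, \<lambda>(m, k). delay e m k \<omega>))
        (borel \<Otimes>\<^sub>M signal_space))
    | Claim j r \<Rightarrow> sets (vimage_algebra (space M) (claim j r) borel))"
  proof (cases x)
    case Immigration
    then have "signal i x = (\<lambda>\<omega>. \<lambda>(j, k). imm j k \<omega>)" by (simp add: signal_def fun_eq_iff)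
    then show ?thesis
      using Immigration by (auto intro!: in_vimage_algebra)
  next
    case (Reproduction e)
    let ?V = "vimage_algebra (space M) (\<lambda>\<omega>. (mark e \<omega>, \<lambda>(m, k). delay e m k \<omega>)) (borel \<Otimes>\<^sub>M signal_space)"
    have "(\<lambda>\<omega>. (mark e \<omega>, \<lambda>(m, k). delay e m k \<omega>)) \<in> measurable ?V (borel \<Otimes>\<^sub>M signal_space)"
      by (rule measurable_vimage_algebra1) (auto simp: space_pair_measure space_PiM)
    from measurable_compose[OF this measurable_snd]
    have "signal i x \<in> measurable ?V signal_space"
      using Reproduction by (simp add: signal_def[abs_def])
    then show ?thesis
      using Reproduction by (auto dest: measurable_sets)
  next
    case (Claim j r)
    let ?V = "vimage_algebra (space M) (claim j r) borel"
    have "claim j r \<in> measurable ?V borel"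
      by (rule measurable_vimage_algebra1) auto
    then have "(\<lambda>\<omega>. ereal (claim j r \<omega> $ i)) \<in> borel_measurable ?V"
      by measurable
    then have "signal i x \<in> measurable ?V signal_space"
      using Claim by (auto simp: signal_def intro!: measurable_PiM_single')
    then show ?thesis
      using Claim by (auto dest: measurable_sets)
  qed
qed

text \<open>
  The sigma-algebra generated by the sources in \<open>K\<close>. Independence of derived quantities is obtained
  by showing that they are measurable with respect to disjoint sets of sources.
\<close>
definition info :: "'s \<Rightarrow> 'd source set \<Rightarrow> 'w measure" where
  "info i K = vimage_algebra (space M) (\<lambda>\<omega>. \<lambda>x\<in>K. signal i x \<omega>) (\<Pi>\<^sub>M x\<in>K. signal_space)"

lemma space_info [simp]: "space (info i K) = space M"
  by (simp add: info_def)

lemma sets_info: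
  "sets (info i K) = {(\<lambda>\<omega>. \<lambda>x\<in>K. signal i x \<omega>) -` A \<inter> space M |A. A \<in> sets (\<Pi>\<^sub>M x\<in>K. signal_space)}"
  unfolding info_def by (rule sets_vimage_algebra2) (auto simp: space_PiM PiE_def)

lemma measurable_signal_info: "x \<in> K \<Longrightarrow> signal i x \<in> measurable (info i K) signal_space"
proof -
  assume x: "x \<in> K"
  have "(\<lambda>\<omega>. \<lambda>x\<in>K. signal i x \<omega>) \<in> measurable (info i K) (\<Pi>\<^sub>M x\<in>K. signal_space)"
    unfolding info_def by (rule measurable_vimage_algebra1) (auto simp: space_PiM PiE_def)
  from measurable_compose[OF this measurable_component_singleton[OF x]] x
  show ?thesis by simp
qed

lemma measurable_imm_info: "Immigration \<in> K \<Longrightarrow> imm j k \<in> borel_measurable (info i K)"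
  using measurable_compose[OF measurable_signal_info[of Immigration K i] measurable_component_singleton[of "(j, k)"]]
  by (simp add: signal_def)

lemma measurable_delay_info: "Reproduction e \<in> K \<Longrightarrow> delay e m k \<in> borel_measurable (info i K)"
  using measurable_compose[OF measurable_signal_info[of "Reproduction e" K i]
    measurable_component_singleton[of "(m, k)"]]
  by (simp add: signal_def)

lemma measurable_claim_info:
  assumes "Claim j r \<in> K" shows "(\<lambda>\<omega>. claim j r \<omega> $ i) \<in> borel_measurable (info i K)"
proof -
  have "(\<lambda>\<omega>. ereal (claim j r \<omega> $ i)) \<in> borel_measurable (info i K)"
    using measurable_compose[OF measurable_signal_info[OF assms, of i]
      measurable_component_singleton[of "(undefined, 0)"]]
    by (simp add: signal_def)
  from measurable_compose[OF this borel_measurable_real_of_ereal[OF measurable_ident]]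
  show ?thesis by simp
qed

lemma measurable_info_mono:
  assumes K: "K \<subseteq> K'" and Y: "Y \<in> measurable (info i K) L"
  shows "Y \<in> measurable (info i K') L"
proof (rule measurableI)
  have r: "(\<lambda>\<omega>. \<lambda>x\<in>K. signal i x \<omega>) \<in> measurable (info i K') (\<Pi>\<^sub>M x\<in>K. signal_space)"
    using K by (intro measurable_restrict measurable_signal_info) auto
  fix A assume "A \<in> sets L"
  then have "Y -` A \<inter> space M \<in> sets (info i K)"
    using measurable_sets[OF Y] by simp
  then show "Y -` A \<inter> space (info i K') \<in> sets (info i K')"
    using measurable_sets[OF r] by (auto simp: sets_info[of i K])
qed (use measurable_space[OF Y] in auto)

lemma measurable_info:
  assumes Y: "Y \<in> measurable (info i K) L"
  shows "Y \<in> measurable M L"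
proof (rule measurableI)
  have r: "(\<lambda>\<omega>. \<lambda>x\<in>K. signal i x \<omega>) \<in> measurable M (\<Pi>\<^sub>M x\<in>K. signal_space)"
    by (intro measurable_restrict measurable_signal)
  fix A assume "A \<in> sets L"
  then have "Y -` A \<inter> space M \<in> sets (info i K)"
    using measurable_sets[OF Y] by simp
  then show "Y -` A \<inter> space M \<in> sets M"
    using measurable_sets[OF r] by (auto simp: sets_info[of i K])
qed (use measurable_space[OF Y] in auto)

lemma indep_vars_info:
  assumes K: "disjoint_family_on K J"
    and Y: "\<And>j. j \<in> J \<Longrightarrow> Y j \<in> measurable (info i (K j)) (L j)"
  shows "indep_vars L Y J"
proof -
  have ind: "indep_vars (\<lambda>j. \<Pi>\<^sub>M x\<in>K j. signal_space) (\<lambda>j \<omega>. \<lambda>x\<in>K j. signal i x \<omega>) J"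
    by (intro indep_vars_restrict[OF indep_vars_signal] K) auto
  show ?thesis
    unfolding indep_vars_def2
  proof (intro conjI ballI)
    show "indep_sets (\<lambda>j. {Y j -` A \<inter> space M |A. A \<in> sets (L j)}) J"
      using ind[unfolded indep_vars_def2, THEN conjunct2]
    proof (rule indep_sets_mono_sets)
      fix j assume "j \<in> J"
      with Y have "Y j -` A \<inter> space M \<in> sets (info i (K j))" if "A \<in> sets (L j)" for A
        using measurable_sets[OF Y that] by simp
      then show "{Y j -` A \<inter> space M |A. A \<in> sets (L j)} \<subseteq>
          {(\<lambda>\<omega>. \<lambda>x\<in>K j. signal i x \<omega>) -` A \<inter> space M |A. A \<in> sets (\<Pi>\<^sub>M x\<in>K j. signal_space)}"
        by (auto simp: sets_info)
    qed
  qed (use Y measurable_info in blast)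
qed

lemma indep_var_info:
  assumes "K1 \<inter> K2 = {}" "Y1 \<in> measurable (info i K1) L1" "Y2 \<in> measurable (info i K2) L2"
  shows "indep_var L1 Y1 L2 Y2"
  unfolding indep_var_def
  using assms by (intro indep_vars_info[where K="case_bool K1 K2"])
    (auto simp: disjoint_family_on_def split: bool.splits)

lemma nn_integral_freeze_info:
  assumes K: "K1 \<inter> K2 = {}" and C: "countable C"
    and R: "R \<in> measurable (info i K1) (count_space C)"
    and h: "\<And>c. c \<in> C \<Longrightarrow> h c \<in> borel_measurable (info i K2)"
  shows "(\<integral>\<^sup>+\<omega>. h (R \<omega>) \<omega> \<partial>M) = (\<integral>\<^sup>+\<omega>'. \<integral>\<^sup>+\<omega>. h (R \<omega>') \<omega> \<partial>M \<partial>M)"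
proof (rule nn_integral_freeze[OF C measurable_info[OF R]])
  fix c assume "c \<in> C"
  have "(\<lambda>\<omega>. indicator {c} (R \<omega>) :: ennreal) \<in> borel_measurable (info i K1)"
    using R by (rule measurable_compose) simp
  then show "indep_var borel (\<lambda>\<omega>. indicator {c} (R \<omega>)) borel (h c)"
    using h[OF \<open>c \<in> C\<close>] by (rule indep_var_info[OF K])
qed

end


section \<open>The law of truncated clusters\<close>

lemma measurable_sum_count_space:
  fixes X :: "'q \<Rightarrow> 'w \<Rightarrow> 'b :: {countable, comm_monoid_add}"
  assumes "finite K" "\<And>p. p \<in> K \<Longrightarrow> X p \<in> measurable N (count_space UNIV)"
  shows "(\<lambda>\<omega>. \<Sum>p\<in>K. X p \<omega>) \<in> measurable N (count_space UNIV)"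
proof -
  have "(\<lambda>\<omega>. \<lambda>p\<in>K. X p \<omega>) \<in> measurable N (\<Pi>\<^sub>M p\<in>K. count_space UNIV)"
    using assms by (intro measurable_restrict)
  from measurable_compose[OF this measurable_PiM_sum_count_space[OF assms(1) order_refl]]
  show ?thesis by simp
qed

lemma (in prob_space) nn_integral_countable_expand:
  fixes X :: "'a \<Rightarrow> 'b :: countable" and h :: "'b \<Rightarrow> ennreal"
  assumes [measurable]: "X \<in> measurable M (count_space UNIV)"
  shows "(\<integral>\<^sup>+\<omega>. h (X \<omega>) \<partial>M)
    = (\<integral>\<^sup>+\<kappa>. h \<kappa> * emeasure M {\<omega>\<in>space M. X \<omega> = \<kappa>} \<partial>count_space UNIV)"
proof -
  have "(\<integral>\<^sup>+\<omega>. h (X \<omega>) \<partial>M)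
      = (\<integral>\<^sup>+\<omega>. \<integral>\<^sup>+\<kappa>. h \<kappa> * indicator {\<omega>\<in>space M. X \<omega> = \<kappa>} \<omega> \<partial>count_space UNIV \<partial>M)"
  proof (rule nn_integral_cong)
    fix \<omega> assume "\<omega> \<in> space M"
    then have "(\<integral>\<^sup>+\<kappa>. h \<kappa> * indicator {\<omega>\<in>space M. X \<omega> = \<kappa>} \<omega> \<partial>count_space UNIV)
        = (\<integral>\<^sup>+\<kappa>. h \<kappa> * indicator {X \<omega>} \<kappa> \<partial>count_space UNIV)"
      by (intro nn_integral_cong) (auto split: split_indicator)
    then show "h (X \<omega>) = (\<integral>\<^sup>+\<kappa>. h \<kappa> * indicator {\<omega>\<in>space M. X \<omega> = \<kappa>} \<omega> \<partial>count_space UNIV)"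
      by simp
  qed
  also have "\<dots> = (\<integral>\<^sup>+\<kappa>. \<integral>\<^sup>+\<omega>. h \<kappa> * indicator {\<omega>\<in>space M. X \<omega> = \<kappa>} \<omega> \<partial>M \<partial>count_space UNIV)"
    by (rule nn_integral_count_space_nn_integral) auto
  also have "\<dots> = (\<integral>\<^sup>+\<kappa>. h \<kappa> * emeasure M {\<omega>\<in>space M. X \<omega> = \<kappa>} \<partial>count_space UNIV)"
    by (intro nn_integral_cong nn_integral_cmult_indicator) auto
  finally show ?thesis .
qed

text \<open>
  Indicators as test functions recover the definition of independence.
\<close>
lemma (in prob_space) indep_vars_test_functions:
  assumes J: "finite J" and X: "\<And>j. j \<in> J \<Longrightarrow> X j \<in> measurable M (N j)"
    and prod: "\<And>f :: 'j \<Rightarrow> 'b \<Rightarrow> ennreal. (\<And>j. j \<in> J \<Longrightarrow> f j \<in> borel_measurable (N j)) \<Longrightarrow>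
      (\<integral>\<^sup>+\<omega>. (\<Prod>j\<in>J. f j (X j \<omega>)) \<partial>M) = (\<Prod>j\<in>J. \<integral>\<^sup>+\<omega>. f j (X j \<omega>) \<partial>M)"
  shows "indep_vars N X J"
  unfolding indep_vars_def2
proof (intro conjI ballI indep_setsI)
  show "{X j -` A \<inter> space M |A. A \<in> sets (N j)} \<subseteq> events" if "j \<in> J" for j
    using X[OF that] by (auto intro: measurable_sets)
next
  fix A K assume K: "K \<noteq> {}" "K \<subseteq> J" "finite K"
    and A: "\<forall>j\<in>K. A j \<in> {X j -` A \<inter> space M |A. A \<in> sets (N j)}"
  from A have "\<forall>j\<in>K. \<exists>B. A j = X j -` B \<inter> space M \<and> B \<in> sets (N j)" by auto
  then obtain B where B: "A j = X j -` B j \<inter> space M" "B j \<in> sets (N j)" if "j \<in> K" for j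
    by (metis (no_types))
  define f where "f j x = (if j \<in> K then indicator (B j) x else 1 :: ennreal)" for j x
  have f: "f j \<in> borel_measurable (N j)" for j
    using B by (cases "j \<in> K") (auto simp: f_def[abs_def])
  have Aj: "A j \<in> events" if "j \<in> K" for j
    using B[OF that] X[of j] that K(2) by auto
  have "(\<Prod>j\<in>J. f j (X j \<omega>)) = indicator (\<Inter>j\<in>K. A j) \<omega>" if "\<omega> \<in> space M" for \<omega>
  proof -
    have "(\<Prod>j\<in>J. f j (X j \<omega>)) = (\<Prod>j\<in>K. indicator (A j) \<omega>)"
      using K J that B(1) by (intro prod.mono_neutral_cong_right) (auto simp: f_def split: split_indicator)
    also have "\<dots> = indicator (\<Inter>j\<in>K. A j) \<omega>"
      using K(3) by (auto simp: prod_eq_1_iff split: split_indicator)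
    finally show ?thesis .
  qed
  then have "(\<integral>\<^sup>+\<omega>. (\<Prod>j\<in>J. f j (X j \<omega>)) \<partial>M) = (\<integral>\<^sup>+\<omega>. indicator (\<Inter>j\<in>K. A j) \<omega> \<partial>M)"
    by (rule nn_integral_cong)
  also have "\<dots> = emeasure M (\<Inter>j\<in>K. A j)"
    using K Aj by (intro nn_integral_indicator sets.finite_INT) auto
  finally have 1: "(\<integral>\<^sup>+\<omega>. (\<Prod>j\<in>J. f j (X j \<omega>)) \<partial>M) = emeasure M (\<Inter>j\<in>K. A j)" .
  have "(\<integral>\<^sup>+\<omega>. f j (X j \<omega>) \<partial>M) = (if j \<in> K then emeasure M (A j) else 1)" for j
  proof (cases "j \<in> K")
    case True
    then have "(\<integral>\<^sup>+\<omega>. f j (X j \<omega>) \<partial>M) = (\<integral>\<^sup>+\<omega>. indicator (A j) \<omega> \<partial>M)"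
      using B(1)[OF True] by (intro nn_integral_cong) (auto simp: f_def split: split_indicator)
    then show ?thesis using True Aj by simp
  qed (simp add: f_def emeasure_space_1)
  then have "(\<Prod>j\<in>J. \<integral>\<^sup>+\<omega>. f j (X j \<omega>) \<partial>M) = (\<Prod>j\<in>K. emeasure M (A j))"
    using K J by (simp add: prod.If_cases Int_absorb1)
  with 1 prod[OF f] have "emeasure M (\<Inter>j\<in>K. A j) = (\<Prod>j\<in>K. emeasure M (A j))" by simp
  then have "ennreal (prob (\<Inter>j\<in>K. A j)) = ennreal (\<Prod>j\<in>K. prob (A j))"
    by (simp add: emeasure_eq_measure prod_ennreal)
  then show "prob (\<Inter> (A ` K)) = (\<Prod>j\<in>K. prob (A j))"
    by (simp add: prod_nonneg)
qed (use X in auto)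

context compound_hawkes
begin

lemma measurable_points_info:
  fixes T :: "'d \<Rightarrow> nat \<Rightarrow> 'w \<Rightarrow> ereal"
  assumes "\<And>m k. T m k \<in> borel_measurable (info i K)" "A \<in> sets borel"
  shows "(\<lambda>\<omega>. fin_part (points T A \<omega>)) \<in> measurable (info i K) (count_space (Collect finite))"
  by (intro measurable_fin_part sets_points assms)

lemma measurable_counts:
  assumes "(\<lambda>\<omega>. R \<omega>) \<in> measurable N (count_space (Collect finite))"
  shows "(\<lambda>\<omega>. counts (R \<omega>)) \<in> measurable N (count_space UNIV)"
  using measurable_compose[OF assms, of counts "count_space UNIV"] by simp

lemma delay_intensity_nonneg:
  assumes "A \<subseteq> {0<..}"
  shows "0 \<le> (LBINT s:A. g m j s)"
  unfolding set_lebesgue_integral_def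
  using assms g_nonneg by (intro Bochner_Integration.integral_nonneg) (auto split: split_indicator)

lemma AE_mark_nonneg: "AE \<omega> in M. \<forall>m. 0 \<le> mark e \<omega> $ m"
proof -
  have "AE b in distr M borel (mark e). \<forall>m. 0 \<le> b $ m"
    using B_nonneg[of "component e"] unfolding mark_law .
  then show ?thesis by (subst (asm) AE_distr_iff) auto
qed

lemma AE_finite_delay:
  assumes A: "A \<in> sets borel" "bounded A" "A \<subseteq> {0<..}"
  shows "AE \<omega> in M. finite (points (delay e) A \<omega>)"
proof -
  show ?thesis
    by (rule AE_finite_points[OF reproduction A])
       (use AE_mark_nonneg[of e] delay_intensity_nonneg[OF A(3)] in \<open>auto elim!: eventually_mono\<close>)
qed

text \<open>
  Given the mark, the counts are Poisson with parameters that depend on the event only through its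
  component, and the law of the mark depends only on the component as well.
\<close>
lemma distr_delay_counts:
  assumes A: "A \<in> sets borel" "bounded A" "A \<subseteq> {0<..}" and e: "component e = component e'"
  shows "distr M (count_space UNIV) (\<lambda>\<omega>. counts (fin_part (points (delay e) A \<omega>)))
    = distr M (count_space UNIV) (\<lambda>\<omega>. counts (fin_part (points (delay e') A \<omega>)))"
proof -
  have meas: "(\<lambda>\<omega>. counts (fin_part (points (delay e) A \<omega>))) \<in> measurable M (count_space UNIV)" for e
    using sets_points[of "delay e" M A] A by (intro measurable_counts measurable_fin_part) auto
  have eq: "prob {\<omega>\<in>space M. counts (fin_part (points (delay e) A \<omega>)) = \<kappa>}
    = (\<integral>b. (\<Prod>m\<in>UNIV. poisson_weight (LBINT s:A. b $ m * g m (component e) s) (\<kappa> m)) \<partial>B (component e))"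
    for \<kappa> e
  proof -
    have "prob {\<omega>\<in>space M. counts (fin_part (points (delay e) A \<omega>)) = \<kappa>}
        = prob {\<omega>\<in>space M. finite (points (delay e) A \<omega>) \<and> counts (points (delay e) A \<omega>) = \<kappa>}"
    proof (rule finite_measure_eq_AE)
      show "AE \<omega> in M. \<omega> \<in> {\<omega>\<in>space M. counts (fin_part (points (delay e) A \<omega>)) = \<kappa>} \<longleftrightarrow>
          \<omega> \<in> {\<omega>\<in>space M. finite (points (delay e) A \<omega>) \<and> counts (points (delay e) A \<omega>) = \<kappa>}"
        using AE_finite_delay[OF A, of e] by eventually_elim (simp add: fin_part_def)
      show "{\<omega>\<in>space M. counts (fin_part (points (delay e) A \<omega>)) = \<kappa>} \<in> events"
        using measurable_sets[OF meas, of "{\<kappa>}" e] by (simp add: vimage_def Int_def conj_commute)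
    qed (rule sets_points_event, use A in auto)
    also have "\<dots> = (\<integral>\<omega>. (\<Prod>m\<in>UNIV. poisson_weight (LBINT s:A. mark e \<omega> $ m * g m (component e) s) (\<kappa> m)) \<partial>M)"
      by (rule cond_poisson_single[OF reproduction A])
    also have "\<dots> = (\<integral>b. (\<Prod>m\<in>UNIV. poisson_weight (LBINT s:A. b $ m * g m (component e) s) (\<kappa> m)) \<partial>distr M borel (mark e))"
      by (subst integral_distr) (auto simp: poisson_weight_def)
    finally show ?thesis by (simp add: mark_law)
  qed
  show ?thesis
  proof (rule measure_eqI_countable[of _ UNIV])
    fix \<kappa> :: "'d \<Rightarrow> nat"
    have "(\<lambda>\<omega>. counts (fin_part (points (delay e) A \<omega>))) -` {\<kappa>} \<inter> space M
        = {\<omega>\<in>space M. counts (fin_part (points (delay e) A \<omega>)) = \<kappa>}" for e by auto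
    then show "emeasure (distr M (count_space UNIV) (\<lambda>\<omega>. counts (fin_part (points (delay e) A \<omega>)))) {\<kappa>}
        = emeasure (distr M (count_space UNIV) (\<lambda>\<omega>. counts (fin_part (points (delay e') A \<omega>)))) {\<kappa>}"
      using meas by (simp add: emeasure_distr emeasure_eq_measure eq e)
  qed auto
qed

text \<open>
  The number of events of each component among the first \<open>n\<close> generations of descendants of \<open>e\<close>
  (including \<open>e\<close>) that can be reached through delays at most \<open>v\<close>. On the null event of infinitely
  many children the sum takes its default value 0.
\<close>
primrec progeny :: "nat \<Rightarrow> nat \<Rightarrow> 'd event \<Rightarrow> 'w \<Rightarrow> nat ^ 'd" where
  "progeny v 0 e \<omega> = axis (component e) 1"
| "progeny v (Suc n) e \<omega> = axis (component e) 1 +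
    (\<Sum>p\<in>points (delay e) {0<..real v} \<omega>. progeny v n (Offspring e (fst p) (snd p)) \<omega>)"

lemma measurable_progeny:
  "progeny v n e \<in> measurable (info i (Reproduction ` Collect (progenitor e))) (count_space UNIV)"
proof (induction n arbitrary: e)
  case (Suc n)
  let ?I = "info i (Reproduction ` Collect (progenitor e))"
  let ?R = "\<lambda>\<omega>. fin_part (points (delay e) {0<..real v} \<omega>)"
  have X: "progeny v n (Offspring e (fst p) (snd p)) \<in> measurable ?I (count_space UNIV)" for p
    using progenitor_child by (intro measurable_info_mono[OF _ Suc.IH] image_mono) auto
  have sum: "(\<lambda>\<omega>. \<Sum>p\<in>R. progeny v n (Offspring e (fst p) (snd p)) \<omega>) \<in> measurable ?I (count_space UNIV)"
    if "R \<in> Collect finite" for R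
    using that by (intro measurable_sum_count_space X) auto
  have R: "?R \<in> measurable ?I (count_space (Collect finite))"
    by (intro measurable_points_info measurable_delay_info) auto
  have "(\<lambda>\<omega>. \<Sum>p\<in>?R \<omega>. progeny v n (Offspring e (fst p) (snd p)) \<omega>) \<in> measurable ?I (count_space UNIV)"
    by (rule measurable_compose_countable'[OF sum R countable_finite_sets])
  from measurable_compose[OF this, of "\<lambda>x. axis (component e) 1 + x" "count_space UNIV"]
  show ?case by simp
next
  case 0
  have "progeny v 0 e = (\<lambda>_. axis (component e) 1)" by (simp add: fun_eq_iff)
  then show ?case by simp
qed

lemma measurable_progeny' [measurable]: "progeny v n e \<in> measurable M (count_space UNIV)"
  by (rule measurable_info[OF measurable_progeny])

lemma indep_vars_progeny:
  assumes "\<And>p q. p \<in> J \<Longrightarrow> q \<in> J \<Longrightarrow> p \<noteq> q \<Longrightarrow> \<not> (\<exists>f. progenitor (E p) f \<and> progenitor (E q) f)"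
  shows "indep_vars (\<lambda>_. count_space UNIV) (\<lambda>p. progeny v n (E p)) J"
proof -
  have "disjoint_family_on (\<lambda>p. Reproduction ` Collect (progenitor (E p))) J"
    unfolding disjoint_family_on_def
  proof (intro ballI impI)
    fix p q assume "p \<in> J" "q \<in> J" "p \<noteq> q"
    from assms[OF this] show "Reproduction ` Collect (progenitor (E p)) \<inter> Reproduction ` Collect (progenitor (E q)) = {}"
      by blast
  qed
  then show ?thesis
    by (rule indep_vars_info) (rule measurable_progeny)
qed

lemma indep_vars_progeny_offspring:
  "indep_vars (\<lambda>_. count_space UNIV) (\<lambda>p. progeny v n (Offspring e (fst p) (snd p))) J"
  by (rule indep_vars_progeny) (auto dest: progenitor_siblings simp: prod_eq_iff)

lemma indep_vars_progeny_immigrant: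
  "indep_vars (\<lambda>_. count_space UNIV) (\<lambda>p. progeny v n (Immigrant (fst p) (snd p))) J"
  by (rule indep_vars_progeny) (auto dest!: progenitor_ancestor simp: prod_eq_iff)

text \<open>
  Induction on the number of generations. Conditionally on the set of children, the progenies of the
  children are independent, with laws that depend only on their components by the induction hypothesis.
  The law of their sum is thus a function of the numbers of children in each component, whose joint law
  depends only on the component of the root.
\<close>
lemma distr_progeny:
  "component e = component e' \<Longrightarrow>
    distr M (count_space UNIV) (progeny v n e) = distr M (count_space UNIV) (progeny v n e')"
proof (induction n arbitrary: e e')
  case 0
  then have "progeny v 0 e = progeny v 0 e'" by (simp add: fun_eq_iff)
  then show ?case by simp
next
  case (Suc n)
  let ?A = "{0<..real v}"
  let ?R = "\<lambda>e \<omega>. fin_part (points (delay e) ?A \<omega>)"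
  let ?X = "\<lambda>e p. progeny v n (Offspring e (fst p) (snd p))"
  define \<Psi> where "\<Psi> S e R = (\<integral>\<^sup>+\<omega>. indicator S (axis (component e) 1 + (\<Sum>p\<in>R. ?X e p \<omega>)) \<partial>M)"
    for S :: "(nat ^ 'd) set" and e R
  define \<psi> where "\<psi> S \<kappa> = \<Psi> S e (SOME R. finite R \<and> counts R = \<kappa>)" for S \<kappa>
  have \<Psi>: "\<Psi> S e1 R = \<psi> S (counts R)" if "finite R" "component e1 = component e" for S e1 R
  proof -
    let ?R' = "SOME R'. finite R' \<and> counts R' = counts R"
    have R': "finite ?R'" "counts ?R' = counts R"
      using someI[of "\<lambda>R'. finite R' \<and> counts R' = counts R" R] that by auto
    show ?thesis
      unfolding \<psi>_def \<Psi>_def that(2)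
      using that R' by (intro nn_integral_sum_counts_eq indep_vars_progeny_offspring Suc.IH) auto
  qed
  have meas: "(\<lambda>\<omega>. counts (?R e \<omega>)) \<in> measurable M (count_space UNIV)" for e
    using sets_points[of "delay e" M ?A] by (intro measurable_counts measurable_fin_part) auto
  have main: "emeasure (distr M (count_space UNIV) (progeny v (Suc n) e1)) S
      = (\<integral>\<^sup>+\<kappa>. \<psi> S \<kappa> \<partial>distr M (count_space UNIV) (\<lambda>\<omega>. counts (?R e1 \<omega>)))"
    if e1: "component e1 = component e" for e1 S
  proof -
    fix i :: 's
    have R: "?R e1 \<in> measurable (info i {Reproduction e1}) (count_space (Collect finite))"
      by (intro measurable_points_info measurable_delay_info) auto
    have X: "?X e1 p \<in> measurable (info i (Reproduction ` {f. progenitor e1 f \<and> f \<noteq> e1})) (count_space UNIV)" for p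
      by (intro measurable_info_mono[OF image_mono measurable_progeny]) (auto dest: progenitor_child)
    have H: "(\<lambda>\<omega>. indicator S (axis (component e1) 1 + (\<Sum>p\<in>R. ?X e1 p \<omega>)))
        \<in> borel_measurable (info i (Reproduction ` {f. progenitor e1 f \<and> f \<noteq> e1}))"
      if "R \<in> Collect finite" for R
      using that by (intro measurable_compose[OF measurable_sum_count_space[OF _ X]]) auto
    have "emeasure (distr M (count_space UNIV) (progeny v (Suc n) e1)) S
        = (\<integral>\<^sup>+\<omega>. indicator S (progeny v (Suc n) e1 \<omega>) \<partial>M)"
      by (subst nn_integral_distr[symmetric, where M'="count_space UNIV"])
         (auto simp del: progeny.simps intro!: measurable_progeny')
    also have "\<dots> = (\<integral>\<^sup>+\<omega>. indicator S (axis (component e1) 1 + (\<Sum>p\<in>?R e1 \<omega>. ?X e1 p \<omega>)) \<partial>M)"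
      by simp
    also have "\<dots> = (\<integral>\<^sup>+\<omega>'. \<Psi> S e1 (?R e1 \<omega>') \<partial>M)"
      unfolding \<Psi>_def by (rule nn_integral_freeze_info[OF _ countable_finite_sets R H]) auto
    also have "\<dots> = (\<integral>\<^sup>+\<omega>'. \<psi> S (counts (?R e1 \<omega>')) \<partial>M)"
      by (simp add: \<Psi> e1)
    also have "\<dots> = (\<integral>\<^sup>+\<kappa>. \<psi> S \<kappa> \<partial>distr M (count_space UNIV) (\<lambda>\<omega>. counts (?R e1 \<omega>)))"
      by (subst nn_integral_distr) (auto intro!: meas)
    finally show "emeasure (distr M (count_space UNIV) (progeny v (Suc n) e1)) S = \<dots>" .
  qed
  have "distr M (count_space UNIV) (\<lambda>\<omega>. counts (?R e \<omega>)) = distr M (count_space UNIV) (\<lambda>\<omega>. counts (?R e' \<omega>))"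
    using Suc.prems by (intro distr_delay_counts) auto
  then show ?case
    using Suc.prems by (intro measure_eqI) (simp_all add: main del: progeny.simps)
qed

end


context compound_hawkes
begin

section \<open>Increments of the dominating process\<close>

lemma imm_poisson: "cond_poisson_process M (count_space (UNIV :: unit set)) (\<lambda>\<omega>. ()) (\<lambda>_ j s. base $ j) imm"
  using immigration by (simp add: poisson_process_def)

lemma imm_intensity_nonneg: "0 \<le> (LBINT s:A. base $ m)"
  unfolding set_lebesgue_integral_def
  using base_nonneg by (intro Bochner_Integration.integral_nonneg) (auto split: split_indicator)

lemma AE_finite_imm:
  assumes A: "A \<in> sets borel" "bounded A" "A \<subseteq> {0<..}"
  shows "AE \<omega> in M. finite (points imm A \<omega>)"
  by (rule AE_finite_points[OF imm_poisson A]) (auto simp: imm_intensity_nonneg)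

lemma measurable_imm_counts:
  assumes "A \<in> sets borel"
  shows "(\<lambda>\<omega>. counts (fin_part (points imm A \<omega>))) \<in> measurable M (count_space UNIV)"
  using assms by (intro measurable_counts measurable_fin_part sets_points) auto

text \<open>
  The description of a Poisson process lists the sets as \<open>A 0, A 1, \<dots>\<close>; an enumeration of \<open>J\<close>
  turns this into a statement about an arbitrary finite family.
\<close>
lemma prob_imm_counts_INT:
  fixes A :: "nat \<Rightarrow> real set"
  assumes A: "\<And>j. j \<in> J \<Longrightarrow> A j \<in> sets borel \<and> bounded (A j) \<and> A j \<subseteq> {0<..}"
    and disj: "disjoint_family_on A J" and J: "finite J" "J \<noteq> {}"
  shows "prob (\<Inter>j\<in>J. {\<omega>\<in>space M. counts (fin_part (points imm (A j) \<omega>)) = \<kappa> j})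
    = (\<Prod>j\<in>J. \<Prod>m\<in>UNIV. poisson_weight (LBINT s:A j. base $ m) (\<kappa> j m))"
proof -
  obtain h where h: "bij_betw h {..<card J} J"
    using ex_bij_betw_nat_finite[OF J(1)] by (auto simp: atLeast0LessThan)
  have all: "(\<forall>i<card J. P (h i)) \<longleftrightarrow> (\<forall>j\<in>J. P j)" for P
  proof -
    have "(\<forall>i<card J. P (h i)) \<longleftrightarrow> (\<forall>j\<in>h ` {..<card J}. P j)" by auto
    then show ?thesis unfolding bij_betw_imp_surj_on[OF h] .
  qed
  have hJ: "h i \<in> J" if "i < card J" for i
    using bij_betwE[OF h] that by auto
  have disj': "disjoint_family_on (\<lambda>i. A (h i)) {..<card J}"
    unfolding disjoint_family_on_def
  proof (intro ballI impI)
    fix a b assume ab: "a \<in> {..<card J}" "b \<in> {..<card J}" "a \<noteq> b"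
    then have "h a \<noteq> h b" using bij_betw_imp_inj_on[OF h] by (auto dest: inj_onD)
    then show "A (h a) \<inter> A (h b) = {}"
      using disj hJ ab by (auto simp: disjoint_family_on_def)
  qed
  have "prob (\<Inter>j\<in>J. {\<omega>\<in>space M. counts (fin_part (points imm (A j) \<omega>)) = \<kappa> j})
      = prob {\<omega>\<in>space M. () \<in> UNIV \<and>
          (\<forall>i<card J. \<forall>m. npoints (\<lambda>k. imm m k \<omega>) (A (h i)) = enat (\<kappa> (h i) m))}"
  proof (rule finite_measure_eq_AE)
    have "AE \<omega> in M. \<forall>j\<in>J. finite (points imm (A j) \<omega>)"
      using J(1) A AE_finite_imm by (intro AE_finite_allI) auto
    then show "AE \<omega> in M. \<omega> \<in> (\<Inter>j\<in>J. {\<omega>\<in>space M. counts (fin_part (points imm (A j) \<omega>)) = \<kappa> j}) \<longleftrightarrow>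
        \<omega> \<in> {\<omega>\<in>space M. () \<in> UNIV \<and>
          (\<forall>i<card J. \<forall>m. npoints (\<lambda>k. imm m k \<omega>) (A (h i)) = enat (\<kappa> (h i) m))}"
      using AE_space
    proof eventually_elim
      case (elim \<omega>)
      have "(\<forall>i<card J. \<forall>m. npoints (\<lambda>k. imm m k \<omega>) (A (h i)) = enat (\<kappa> (h i) m))
          \<longleftrightarrow> (\<forall>j\<in>J. counts (fin_part (points imm (A j) \<omega>)) = \<kappa> j)"
        unfolding npoints_eq_iff
          all[of "\<lambda>j. finite (points imm (A j) \<omega>) \<and> counts (points imm (A j) \<omega>) = \<kappa> j"]
        using elim by (simp add: fin_part_def)
      then show ?case using elim J(2) by simp
    qed
    show "(\<Inter>j\<in>J. {\<omega>\<in>space M. counts (fin_part (points imm (A j) \<omega>)) = \<kappa> j}) \<in> events"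
    proof (rule sets.finite_INT[OF J])
      fix j assume "j \<in> J"
      then have "(\<lambda>\<omega>. counts (fin_part (points imm (A j) \<omega>))) -` {\<kappa> j} \<inter> space M \<in> events"
        using A by (intro measurable_sets[OF measurable_imm_counts]) auto
      then show "{\<omega>\<in>space M. counts (fin_part (points imm (A j) \<omega>)) = \<kappa> j} \<in> events"
        by (simp add: vimage_def Int_def conj_commute)
    qed
    have "{\<omega>\<in>space M. () \<in> UNIV \<and>
          (\<forall>i<card J. \<forall>m. npoints (\<lambda>k. imm m k \<omega>) (A (h i)) = enat (\<kappa> (h i) m))}
      = (\<Inter>j\<in>J. {\<omega>\<in>space M. finite (points imm (A j) \<omega>) \<and> counts (points imm (A j) \<omega>) = \<kappa> j})"
      using J(2) unfolding npoints_eq_iff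
        all[of "\<lambda>j. finite (points imm (A j) _) \<and> counts (points imm (A j) _) = \<kappa> j"] by auto
    also have "\<dots> \<in> events"
      using A J by (intro sets.finite_INT sets_points_event) auto
    finally show "{\<omega>\<in>space M. () \<in> UNIV \<and>
          (\<forall>i<card J. \<forall>m. npoints (\<lambda>k. imm m k \<omega>) (A (h i)) = enat (\<kappa> (h i) m))} \<in> events" .
  qed
  also have "\<dots> = (\<integral>\<omega>. indicator UNIV () * (\<Prod>i<card J. \<Prod>m\<in>UNIV.
      poisson_weight (LBINT s:A (h i). base $ m) (\<kappa> (h i) m)) \<partial>M)"
    using A hJ disj' by (intro imm_poisson[unfolded cond_poisson_process_def, THEN conjunct2, THEN conjunct2,
      rule_format, of UNIV "card J" "\<lambda>i. A (h i)" "\<lambda>i. \<kappa> (h i)"]) auto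
  also have "\<dots> = (\<Prod>i<card J. \<Prod>m\<in>UNIV. poisson_weight (LBINT s:A (h i). base $ m) (\<kappa> (h i) m))"
    by (simp add: prob_space)
  also have "\<dots> = (\<Prod>j\<in>J. \<Prod>m\<in>UNIV. poisson_weight (LBINT s:A j. base $ m) (\<kappa> j m))"
    by (rule prod.reindex_bij_betw[OF h])
  finally show ?thesis .
qed

lemma prob_imm_counts:
  assumes A: "A \<in> sets borel" "bounded A" "A \<subseteq> {0<..}"
  shows "prob {\<omega>\<in>space M. counts (fin_part (points imm A \<omega>)) = \<kappa>}
    = (\<Prod>m\<in>UNIV. poisson_weight (LBINT s:A. base $ m) (\<kappa> m))"
  using prob_imm_counts_INT[of "{0}" "\<lambda>_. A" "\<lambda>_. \<kappa>"] A by (simp add: disjoint_family_on_def)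

text \<open>
  Singletons together with the empty set form an intersection-stable generator of the events of a
  discrete variable.
\<close>
lemma indep_vars_imm_counts:
  fixes A :: "nat \<Rightarrow> real set"
  assumes A: "\<And>j. j \<in> J \<Longrightarrow> A j \<in> sets borel \<and> bounded (A j) \<and> A j \<subseteq> {0<..}"
    and disj: "disjoint_family_on A J"
  shows "indep_vars (\<lambda>_. count_space UNIV) (\<lambda>j \<omega>. counts (fin_part (points imm (A j) \<omega>))) J"
proof -
  let ?N = "\<lambda>j \<omega>. counts (fin_part (points imm (A j) \<omega>))"
  define F where "F j = insert {} (range (\<lambda>\<kappa>. {\<omega>\<in>space M. ?N j \<omega> = \<kappa>}))" for j
  have meas: "?N j \<in> measurable M (count_space UNIV)" if "j \<in> J" for j
    using A[OF that] by (intro measurable_imm_counts) auto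
  have ev: "{\<omega>\<in>space M. ?N j \<omega> = \<kappa>} \<in> events" if "j \<in> J" for j \<kappa>
    using measurable_sets[OF meas[OF that], of "{\<kappa>}"] by (simp add: vimage_def Int_def conj_commute)
  have "indep_sets F J"
  proof (rule indep_setsI)
    show "F j \<subseteq> events" if "j \<in> J" for j
      using ev[OF that] by (auto simp: F_def)
    fix E K assume K: "K \<noteq> {}" "K \<subseteq> J" "finite K" and E: "\<forall>j\<in>K. E j \<in> F j"
    show "prob (\<Inter> (E ` K)) = (\<Prod>j\<in>K. prob (E j))"
    proof (cases "\<exists>j\<in>K. E j = {}")
      case True
      then have "\<Inter> (E ` K) = {}" by auto
      moreover have "(\<Prod>j\<in>K. prob (E j)) = 0"
        using True by (intro prod_zero K(3)) (metis measure_empty)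
      ultimately show ?thesis by simp
    next
      case False
      have "\<forall>j\<in>K. \<exists>\<kappa>. E j = {\<omega>\<in>space M. ?N j \<omega> = \<kappa>}"
      proof
        fix j assume "j \<in> K"
        then have "E j \<in> F j" "E j \<noteq> {}" using E False by auto
        then show "\<exists>\<kappa>. E j = {\<omega>\<in>space M. ?N j \<omega> = \<kappa>}" by (auto simp: F_def)
      qed
      then obtain \<kappa> where \<kappa>: "\<And>j. j \<in> K \<Longrightarrow> E j = {\<omega>\<in>space M. ?N j \<omega> = \<kappa> j}"
        by metis
      have "prob (\<Inter> (E ` K)) = prob (\<Inter>j\<in>K. {\<omega>\<in>space M. ?N j \<omega> = \<kappa> j})"
        using \<kappa> by (intro arg_cong[where f=prob] INF_cong) auto
      also have "\<dots> = (\<Prod>j\<in>K. \<Prod>m\<in>UNIV. poisson_weight (LBINT s:A j. base $ m) (\<kappa> j m))"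
        using A K by (intro prob_imm_counts_INT disjoint_family_on_mono[OF K(2) disj]) auto
      also have "\<dots> = (\<Prod>j\<in>K. prob (E j))"
      proof (rule prod.cong[OF refl])
        fix j assume j: "j \<in> K"
        then have "A j \<in> sets borel" "bounded (A j)" "A j \<subseteq> {0<..}" using A K(2) by auto
        from prob_imm_counts[OF this] show "(\<Prod>m\<in>UNIV. poisson_weight (LBINT s:A j. base $ m) (\<kappa> j m)) = prob (E j)"
          by (simp add: \<kappa>[OF j])
      qed
      finally show ?thesis .
    qed
  qed
  then have ind: "indep_sets (\<lambda>j. sigma_sets (space M) (F j)) J"
  proof (rule indep_sets_sigma)
    show "Int_stable (F j)" for j
      unfolding F_def Int_stable_def by auto
  qed
  show ?thesis
    unfolding indep_vars_def2
  proof (intro conjI ballI meas indep_sets_mono_sets[OF ind])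
    fix j
    have "?N j -` S \<inter> space M \<in> sigma_sets (space M) (F j)" for S
    proof -
      have "?N j -` S \<inter> space M = (\<Union>\<kappa>\<in>S. {\<omega>\<in>space M. ?N j \<omega> = \<kappa>})" by auto
      also have "\<dots> \<in> sigma_sets (space M) (F j)"
      proof -
        interpret S: sigma_algebra "space M" "sigma_sets (space M) (F j)"
          by (rule sigma_algebra_sigma_sets) (auto simp: F_def)
        show ?thesis by (rule S.countable_UN') (auto simp: F_def)
      qed
      finally show ?thesis .
    qed
    then show "{?N j -` S \<inter> space M |S. S \<in> sets (count_space UNIV)} \<subseteq> sigma_sets (space M) (F j)"
      by auto
  qed
qed

lemma imm_counts_transform:
  assumes A: "A \<in> sets borel" "bounded A" "A \<subseteq> {0<..}"
  shows "(\<integral>\<^sup>+\<omega>. (\<Prod>m\<in>UNIV. z m ^ counts (fin_part (points imm A \<omega>)) m) \<partial>M)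
    = (\<Prod>m\<in>UNIV. \<integral>\<^sup>+k. ennreal (poisson_weight (LBINT s:A. base $ m) k) * z m ^ k \<partial>count_space UNIV)"
proof -
  have "(\<integral>\<^sup>+\<omega>. (\<Prod>m\<in>UNIV. z m ^ counts (fin_part (points imm A \<omega>)) m) \<partial>M)
      = (\<integral>\<^sup>+\<kappa>. (\<Prod>m\<in>UNIV. z m ^ \<kappa> m) * (\<Prod>m\<in>UNIV. ennreal (poisson_weight (LBINT s:A. base $ m) (\<kappa> m)))
          \<partial>count_space UNIV)"
    using nn_integral_countable_expand[OF measurable_imm_counts[OF A(1)], of "\<lambda>\<kappa>. \<Prod>m\<in>UNIV. z m ^ \<kappa> m"]
    by (simp add: emeasure_eq_measure prob_imm_counts[OF A] prod_ennreal
          poisson_weight_nonneg imm_intensity_nonneg)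
  also have "\<dots> = (\<integral>\<^sup>+\<kappa>. (\<Prod>m\<in>UNIV. ennreal (poisson_weight (LBINT s:A. base $ m) (\<kappa> m)) * z m ^ \<kappa> m)
          \<partial>count_space UNIV)"
    by (simp add: prod.distrib mult.commute)
  finally show ?thesis
    using nn_integral_count_prod[of "\<lambda>m k. ennreal (poisson_weight (LBINT s:A. base $ m) k) * z m ^ k"] by simp
qed

abbreviation imm_progeny :: "nat \<Rightarrow> 'd \<times> nat \<Rightarrow> 'w \<Rightarrow> nat ^ 'd" where
  "imm_progeny v p \<equiv> progeny v v (Immigrant (fst p) (snd p))"

text \<open>
  The increment of the dominating counting process: every immigrant that arrives in \<open>A\<close> brings its
  whole truncated cluster at once.
\<close>
definition block :: "nat \<Rightarrow> real set \<Rightarrow> 'w \<Rightarrow> nat ^ 'd" where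
  "block v A \<omega> = (\<Sum>p\<in>points imm A \<omega>. imm_progeny v p \<omega>)"

lemma measurable_imm_progeny_info:
  "imm_progeny v p \<in> measurable (info i (range Reproduction)) (count_space UNIV)"
  by (intro measurable_info_mono[OF image_mono measurable_progeny]) auto

lemma measurable_block_info:
  assumes "A \<in> sets borel"
  shows "block v A \<in> measurable (info i (insert Immigration (range Reproduction))) (count_space UNIV)"
proof -
  let ?I = "info i (insert Immigration (range Reproduction))"
  have X: "imm_progeny v p \<in> measurable ?I (count_space UNIV)" for p
    by (rule measurable_info_mono[OF _ measurable_imm_progeny_info]) auto
  have sum: "(\<lambda>\<omega>. \<Sum>p\<in>R. imm_progeny v p \<omega>) \<in> measurable ?I (count_space UNIV)" if "R \<in> Collect finite" for R
    using that by (intro measurable_sum_count_space X) auto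
  have R: "(\<lambda>\<omega>. fin_part (points imm A \<omega>)) \<in> measurable ?I (count_space (Collect finite))"
    using assms by (intro measurable_points_info measurable_imm_info) auto
  have "(\<lambda>\<omega>. \<Sum>p\<in>fin_part (points imm A \<omega>). imm_progeny v p \<omega>) \<in> measurable ?I (count_space UNIV)"
    by (rule measurable_compose_countable'[OF sum R countable_finite_sets])
  then show ?thesis by (simp add: block_def[abs_def])
qed

text \<open>
  The expectation of \<open>f\<close> of the total progeny of a deterministic population of immigrants with
  \<open>\<kappa> m\<close> members in component \<open>m\<close>, for a particular choice of labels.
\<close>
definition mixture :: "nat \<Rightarrow> (nat ^ 'd \<Rightarrow> ennreal) \<Rightarrow> ('d \<Rightarrow> nat) \<Rightarrow> ennreal" where
  "mixture v f \<kappa> = (\<integral>\<^sup>+\<omega>. f (\<Sum>p\<in>(SIGMA m:UNIV. {..<\<kappa> m}). imm_progeny v p \<omega>) \<partial>M)"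

lemma counts_Sigma [simp]: "counts (SIGMA m:UNIV. {..<\<kappa> m}) = \<kappa>"
  by (auto simp: counts_def fun_eq_iff)

lemma nn_integral_imm_progeny:
  assumes "finite R"
  shows "(\<integral>\<^sup>+\<omega>. f (\<Sum>p\<in>R. imm_progeny v p \<omega>) \<partial>M) = mixture v f (counts R)"
  unfolding mixture_def
  using assms
  by (intro nn_integral_sum_counts_eq indep_vars_progeny_immigrant distr_progeny) auto

text \<open>
  With the immigration frozen, the label sets belonging to disjoint time sets are disjoint, so the
  cluster totals are independent. Each factor is then a function of the immigrant counts, which are
  independent over the time sets.
\<close>
lemma blocks_transform:
  fixes A :: "nat \<Rightarrow> real set"
  assumes A: "\<And>j. j \<in> J \<Longrightarrow> A j \<in> sets borel \<and> bounded (A j) \<and> A j \<subseteq> {0<..}"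
    and disj: "disjoint_family_on A J" and J: "finite J"
  shows "(\<integral>\<^sup>+\<omega>. (\<Prod>j\<in>J. f j (block v (A j) \<omega>)) \<partial>M)
    = (\<Prod>j\<in>J. \<integral>\<^sup>+\<omega>. mixture v (f j) (counts (fin_part (points imm (A j) \<omega>))) \<partial>M)"
proof -
  fix i :: 's
  let ?R = "\<lambda>\<omega>. \<lambda>j\<in>J. fin_part (points imm (A j) \<omega>)"
  let ?C = "J \<rightarrow>\<^sub>E (Collect finite :: ('d \<times> nat) set set)"
  let ?D = "{R\<in>?C. disjoint_family_on R J}"
  have C: "countable ?D"
    using countable_PiE[OF J, of "\<lambda>_. Collect finite :: ('d \<times> nat) set set"] countable_finite_sets
    by (intro countable_subset[of ?D ?C]) auto
  have Rj: "(\<lambda>\<omega>. fin_part (points imm (A j) \<omega>)) \<in> measurable (info i {Immigration}) (count_space (Collect finite))"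
    if "j \<in> J" for j
    using A[OF that] by (intro measurable_points_info measurable_imm_info) auto
  have R: "?R \<in> measurable (info i {Immigration}) (count_space ?D)"
  proof (subst measurable_count_space_eq_countable[OF C], intro conjI ballI funcsetI)
    fix \<omega>
    have "disjoint_family_on (?R \<omega>) J"
      unfolding disjoint_family_on_def
    proof (intro ballI impI)
      fix a b assume ab: "a \<in> J" "b \<in> J" "a \<noteq> b"
      then have "A a \<inter> A b = {}" using disj by (auto simp: disjoint_family_on_def)
      then have "points imm (A a) \<omega> \<inter> points imm (A b) \<omega> = {}" by (auto simp: points_def)
      then show "?R \<omega> a \<inter> ?R \<omega> b = {}" using ab by (auto simp: fin_part_def)
    qed
    then show "?R \<omega> \<in> ?D" by auto
  next
    fix c assume c: "c \<in> ?D"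
    then have "?R -` {c} \<inter> space (info i {Immigration}) = {\<omega>\<in>space (info i {Immigration}).
        \<forall>j\<in>J. fin_part (points imm (A j) \<omega>) = c j}"
      by (auto simp: fun_eq_iff PiE_def extensional_def)
    also have "\<dots> \<in> sets (info i {Immigration})"
    proof (rule sets.sets_Collect_finite_All[OF _ J])
      fix j assume j: "j \<in> J"
      then have "(\<lambda>\<omega>. fin_part (points imm (A j) \<omega>)) -` {c j} \<inter> space (info i {Immigration}) \<in> sets (info i {Immigration})"
        using c by (intro measurable_sets[OF Rj]) auto
      then show "{\<omega>\<in>space (info i {Immigration}). fin_part (points imm (A j) \<omega>) = c j} \<in> sets (info i {Immigration})"
        by (simp add: vimage_def Int_def conj_commute)
    qed
    finally show "?R -` {c} \<inter> space (info i {Immigration}) \<in> sets (info i {Immigration})" .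
  qed
  have sum: "(\<lambda>\<omega>. \<Sum>p\<in>Q. imm_progeny v p \<omega>) \<in> measurable (info i (range Reproduction)) (count_space UNIV)"
    if "finite Q" for Q
    using that by (intro measurable_sum_count_space measurable_imm_progeny_info)
  have H: "(\<lambda>\<omega>. \<Prod>j\<in>J. f j (\<Sum>p\<in>c j. imm_progeny v p \<omega>)) \<in> borel_measurable (info i (range Reproduction))"
    if "c \<in> ?D" for c
    using that by (intro borel_measurable_prod_ennreal measurable_compose[OF sum]) auto
  have inner: "(\<integral>\<^sup>+\<omega>. (\<Prod>j\<in>J. f j (\<Sum>p\<in>c j. imm_progeny v p \<omega>)) \<partial>M)
      = (\<Prod>j\<in>J. mixture v (f j) (counts (c j)))" if c: "c \<in> ?D" for c
  proof -
    define T where "T j = {e :: 'd event. \<exists>p\<in>c j. progenitor (Immigrant (fst p) (snd p)) e}" for j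
    have "disjoint_family_on (\<lambda>j. Reproduction ` T j) J"
      unfolding disjoint_family_on_def
    proof (intro ballI impI)
      fix a b assume ab: "a \<in> J" "b \<in> J" "a \<noteq> b"
      then have "c a \<inter> c b = {}" using c by (auto simp: disjoint_family_on_def)
      then have "T a \<inter> T b = {}"
        by (auto simp: T_def dest!: progenitor_ancestor)
      then show "Reproduction ` T a \<inter> Reproduction ` T b = {}" by auto
    qed
    moreover have "(\<lambda>\<omega>. f j (\<Sum>p\<in>c j. imm_progeny v p \<omega>)) \<in> borel_measurable (info i (Reproduction ` T j))"
      if j: "j \<in> J" for j
    proof -
      have "imm_progeny v p \<in> measurable (info i (Reproduction ` T j)) (count_space UNIV)" if "p \<in> c j" for p
        using that by (intro measurable_info_mono[OF image_mono measurable_progeny]) (auto simp: T_def)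
      then show ?thesis
        using c j by (intro measurable_compose[OF measurable_sum_count_space]) auto
    qed
    ultimately have "indep_vars (\<lambda>_. borel) (\<lambda>j \<omega>. f j (\<Sum>p\<in>c j. imm_progeny v p \<omega>)) J"
      by (rule indep_vars_info)
    then have "(\<integral>\<^sup>+\<omega>. (\<Prod>j\<in>J. f j (\<Sum>p\<in>c j. imm_progeny v p \<omega>)) \<partial>M)
        = (\<Prod>j\<in>J. \<integral>\<^sup>+\<omega>. f j (\<Sum>p\<in>c j. imm_progeny v p \<omega>) \<partial>M)"
      by (intro indep_vars_nn_integral[OF J]) auto
    also have "\<dots> = (\<Prod>j\<in>J. mixture v (f j) (counts (c j)))"
      using c by (intro prod.cong[OF refl] nn_integral_imm_progeny) auto
    finally show ?thesis .
  qed
  have "(\<integral>\<^sup>+\<omega>. (\<Prod>j\<in>J. f j (block v (A j) \<omega>)) \<partial>M)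
      = (\<integral>\<^sup>+\<omega>. (\<Prod>j\<in>J. f j (\<Sum>p\<in>?R \<omega> j. imm_progeny v p \<omega>)) \<partial>M)"
    by (intro nn_integral_cong prod.cong) (auto simp: block_def)
  also have "\<dots> = (\<integral>\<^sup>+\<omega>'. \<integral>\<^sup>+\<omega>. (\<Prod>j\<in>J. f j (\<Sum>p\<in>?R \<omega>' j. imm_progeny v p \<omega>)) \<partial>M \<partial>M)"
    by (rule nn_integral_freeze_info[OF _ C R H]) auto
  also have "\<dots> = (\<integral>\<^sup>+\<omega>'. (\<Prod>j\<in>J. mixture v (f j) (counts (?R \<omega>' j))) \<partial>M)"
    using measurable_space[OF R] by (intro nn_integral_cong inner) (simp only: space_info space_count_space)
  also have "\<dots> = (\<integral>\<^sup>+\<omega>'. (\<Prod>j\<in>J. mixture v (f j) (counts (fin_part (points imm (A j) \<omega>')))) \<partial>M)"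
    by (intro nn_integral_cong prod.cong) auto
  also have "\<dots> = (\<Prod>j\<in>J. \<integral>\<^sup>+\<omega>. mixture v (f j) (counts (fin_part (points imm (A j) \<omega>))) \<partial>M)"
    by (intro indep_vars_nn_integral[OF J] indep_vars_compose2[OF indep_vars_imm_counts[OF A disj]]) auto
  finally show ?thesis .
qed

lemma block_transform:
  assumes A: "A \<in> sets borel" "bounded A" "A \<subseteq> {0<..}"
  shows "(\<integral>\<^sup>+\<omega>. f (block v A \<omega>) \<partial>M) = (\<integral>\<^sup>+\<omega>. mixture v f (counts (fin_part (points imm A \<omega>))) \<partial>M)"
  using blocks_transform[of "{0}" "\<lambda>_. A" "\<lambda>_. f" v] A by (simp add: disjoint_family_on_def)

lemma measurable_block: "A \<in> sets borel \<Longrightarrow> block v A \<in> measurable M (count_space UNIV)"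
  by (rule measurable_info[OF measurable_block_info])

lemma indep_vars_block:
  fixes A :: "nat \<Rightarrow> real set"
  assumes A: "\<And>j. j \<in> J \<Longrightarrow> A j \<in> sets borel \<and> bounded (A j) \<and> A j \<subseteq> {0<..}"
    and disj: "disjoint_family_on A J" and J: "finite J"
  shows "indep_vars (\<lambda>_. count_space UNIV) (\<lambda>j. block v (A j)) J"
proof (rule indep_vars_test_functions[OF J])
  show "block v (A j) \<in> measurable M (count_space UNIV)" if "j \<in> J" for j
    using A[OF that] by (intro measurable_block) auto
  fix f :: "nat \<Rightarrow> nat ^ 'd \<Rightarrow> ennreal"
  show "(\<integral>\<^sup>+\<omega>. (\<Prod>j\<in>J. f j (block v (A j) \<omega>)) \<partial>M) = (\<Prod>j\<in>J. \<integral>\<^sup>+\<omega>. f j (block v (A j) \<omega>) \<partial>M)"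
    using A by (intro trans[OF blocks_transform[OF A disj J]] prod.cong[OF refl] block_transform[symmetric]) auto
qed

text \<open>
  The generating function of a compound Poisson vector: clusters are independent given the number of
  immigrants, and the Poisson weights are summed component by component.
\<close>
lemma block_generating_function:
  assumes A: "A \<in> sets borel" "bounded A" "A \<subseteq> {0<..}"
  shows "(\<integral>\<^sup>+\<omega>. (\<Prod>l\<in>UNIV. z l ^ (block v A \<omega> $ l)) \<partial>M)
    = (\<Prod>m\<in>UNIV. \<integral>\<^sup>+k. ennreal (poisson_weight (LBINT s:A. base $ m) k) *
        (\<integral>\<^sup>+\<omega>. (\<Prod>l\<in>UNIV. z l ^ (progeny v v (Immigrant m 0) \<omega> $ l)) \<partial>M) ^ k \<partial>count_space UNIV)"
proof -
  define f where "f x = (\<Prod>l\<in>UNIV. z l ^ (x $ l))" for x :: "nat ^ 'd"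
  have f_sum: "f (\<Sum>p\<in>S. x p) = (\<Prod>p\<in>S. f (x p))" for S :: "('d \<times> nat) set" and x
  proof -
    have "f (\<Sum>p\<in>S. x p) = (\<Prod>l\<in>UNIV. \<Prod>p\<in>S. z l ^ (x p $ l))"
      by (simp add: f_def sum_component power_sum)
    also have "\<dots> = (\<Prod>p\<in>S. f (x p))"
      unfolding f_def by (rule prod.swap)
    finally show ?thesis .
  qed
  have law: "(\<integral>\<^sup>+\<omega>. f (progeny v v (Immigrant m k) \<omega>) \<partial>M) = (\<integral>\<^sup>+\<omega>. f (progeny v v (Immigrant m 0) \<omega>) \<partial>M)" for m k
  proof -
    have "(\<integral>\<^sup>+\<omega>. f (progeny v v (Immigrant m k) \<omega>) \<partial>M)
        = (\<integral>\<^sup>+x. f x \<partial>distr M (count_space UNIV) (progeny v v (Immigrant m k)))" for k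
      by (subst nn_integral_distr) auto
    then show ?thesis using distr_progeny[of "Immigrant m k" "Immigrant m 0" v v] by simp
  qed
  have "mixture v f \<kappa> = (\<Prod>m\<in>UNIV. (\<integral>\<^sup>+\<omega>. f (progeny v v (Immigrant m 0) \<omega>) \<partial>M) ^ \<kappa> m)" for \<kappa>
  proof -
    have "mixture v f \<kappa> = (\<integral>\<^sup>+\<omega>. (\<Prod>p\<in>(SIGMA m:UNIV. {..<\<kappa> m}). f (imm_progeny v p \<omega>)) \<partial>M)"
      by (simp add: mixture_def f_sum)
    also have "\<dots> = (\<Prod>p\<in>(SIGMA m:UNIV. {..<\<kappa> m}). \<integral>\<^sup>+\<omega>. f (imm_progeny v p \<omega>) \<partial>M)"
    proof (rule indep_vars_nn_integral)
      show "indep_vars (\<lambda>_. borel) (\<lambda>p \<omega>. f (imm_progeny v p \<omega>)) (SIGMA m:UNIV. {..<\<kappa> m})"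
        by (rule indep_vars_compose2[where Y="\<lambda>_. f", OF indep_vars_progeny_immigrant]) simp
    qed auto
    also have "\<dots> = (\<Prod>m\<in>UNIV. \<Prod>k<\<kappa> m. \<integral>\<^sup>+\<omega>. f (progeny v v (Immigrant m k) \<omega>) \<partial>M)"
      using prod.Sigma[of "UNIV :: 'd set" "\<lambda>m. {..<\<kappa> m}" "\<lambda>m k. \<integral>\<^sup>+\<omega>. f (progeny v v (Immigrant m k) \<omega>) \<partial>M"]
      by (simp add: case_prod_beta)
    also have "\<dots> = (\<Prod>m\<in>UNIV. \<Prod>k<\<kappa> m. \<integral>\<^sup>+\<omega>. f (progeny v v (Immigrant m 0) \<omega>) \<partial>M)"
      by (intro prod.cong refl law)
    finally show ?thesis by simp
  qed
  then show ?thesis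
    using block_transform[OF A, of f v] imm_counts_transform[OF A] by (simp add: f_def)
qed

end


section \<open>Domination of the Hawkes process\<close>

lemma ecount_mono: "A \<subseteq> B \<Longrightarrow> ecount A \<le> ecount B"
  by (auto simp: ecount_def card_mono dest: finite_subset)

text \<open>
  For an infinite exponent the inequality holds in the limit, since the powers of a number at least 1
  increase.
\<close>
lemma power_le_epower:
  assumes "1 \<le> x" "enat k \<le> n"
  shows "x ^ k \<le> epower x n"
proof (cases n)
  case (enat m)
  then show ?thesis using assms by (simp add: epower_def power_increasing)
next
  case infinity
  have "eventually (\<lambda>m. x ^ k \<le> x ^ m) sequentially"
    using assms(1) by (intro eventually_sequentiallyI[of k] power_increasing)
  then have "x ^ k \<le> liminf (\<lambda>m. x ^ m)"
    by (rule Liminf_bounded)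
  then show ?thesis using infinity by (simp add: epower_def)
qed

lemma LBINT_const: "a \<le> b \<Longrightarrow> (LBINT s:{a<..b}. c) = (b - a) * (c::real)"
  by (simp add: set_lebesgue_integral_def)

context compound_hawkes
begin

primrec cluster :: "nat \<Rightarrow> nat \<Rightarrow> 'd event \<Rightarrow> 'w \<Rightarrow> 'd event set" where
  "cluster v 0 e \<omega> = {e}"
| "cluster v (Suc n) e \<omega> =
    insert e (\<Union>p\<in>points (delay e) {0<..real v} \<omega>. cluster v n (Offspring e (fst p) (snd p)) \<omega>)"

definition locally_finite :: "'w \<Rightarrow> bool" where
  "locally_finite \<omega> \<longleftrightarrow> (\<forall>v. finite (points imm {0<..real v} \<omega>)) \<and>
    (\<forall>e v. finite (points (delay e) {0<..real v} \<omega>))"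

lemma AE_locally_finite: "AE \<omega> in M. locally_finite \<omega>"
  unfolding locally_finite_def AE_conj_iff AE_all_countable
  by (auto intro: AE_finite_imm AE_finite_delay)

lemma cluster_progenitor: "f \<in> cluster v n e \<omega> \<Longrightarrow> progenitor e f"
  by (induction n arbitrary: e) (auto dest: progenitor_child)

lemma cluster_in_cluster: "f \<in> cluster v n e \<omega> \<Longrightarrow> in_cluster delay e \<omega> \<Longrightarrow> in_cluster delay f \<omega>"
proof (induction n arbitrary: e)
  case (Suc n)
  then show ?case
    by (fastforce simp: points_def)
qed auto

text \<open>
  The progeny vector is defined as a sum over children; it is a genuine cardinality because the subtrees of
  distinct children do not meet and do not contain the parent.
\<close>
lemma progeny_eq_card:
  assumes \<omega>: "locally_finite \<omega>"
  shows "finite (cluster v n e \<omega>) \<and> card {f\<in>cluster v n e \<omega>. component f = l} = progeny v n e \<omega> $ l"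
proof (induction n arbitrary: e)
  case 0
  have "{f. f = e \<and> component f = l} = (if component e = l then {e} else {})" by auto
  then show ?case by (simp add: axis_def)
next
  case (Suc n)
  let ?P = "points (delay e) {0<..real v} \<omega>"
  let ?c = "\<lambda>p. Offspring e (fst p) (snd p)"
  let ?C = "\<lambda>p. {f\<in>cluster v n (?c p) \<omega>. component f = l}"
  have P: "finite ?P" using \<omega> by (simp add: locally_finite_def)
  have fin: "finite (cluster v n (?c p) \<omega>)" for p using Suc.IH by blast
  have "card (\<Union>p\<in>?P. ?C p) = (\<Sum>p\<in>?P. card (?C p))"
  proof (rule card_UN_disjoint[OF P])
    show "\<forall>p\<in>?P. finite (?C p)" using fin by auto
    show "\<forall>p\<in>?P. \<forall>q\<in>?P. p \<noteq> q \<longrightarrow> ?C p \<inter> ?C q = {}"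
    proof (intro ballI impI)
      fix p q :: "'d \<times> nat" assume "p \<noteq> q"
      then show "?C p \<inter> ?C q = {}"
        using progenitor_siblings by (fastforce dest!: cluster_progenitor simp: prod_eq_iff)
    qed
  qed
  also have "\<dots> = (\<Sum>p\<in>?P. progeny v n (?c p) \<omega> $ l)"
    using Suc.IH by simp
  finally have sum: "card (\<Union>p\<in>?P. ?C p) = (\<Sum>p\<in>?P. progeny v n (?c p) \<omega> $ l)" .
  define V where "V = (\<Union>p\<in>?P. ?C p)"
  have V: "finite V" "e \<notin> V"
    using P fin by (auto simp: V_def dest!: cluster_progenitor)
  have "{f\<in>cluster v (Suc n) e \<omega>. component f = l} = (if component e = l then insert e V else V)"
    by (auto simp: V_def)
  then have "card {f\<in>cluster v (Suc n) e \<omega>. component f = l} = progeny v (Suc n) e \<omega> $ l"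
    using V sum[folded V_def] by (simp add: axis_def sum_component)
  then show ?case using P fin by simp
qed

lemma progeny_le_cluster_size:
  assumes "locally_finite \<omega>"
  shows "enat (progeny v n (Immigrant j 0) \<omega> $ l) \<le> cluster_size delay l j \<omega>"
proof -
  have "enat (progeny v n (Immigrant j 0) \<omega> $ l)
      = ecount {f\<in>cluster v n (Immigrant j 0) \<omega>. component f = l}"
    using progeny_eq_card[OF assms, of v n "Immigrant j 0" l] by (simp add: ecount_def)
  also have "\<dots> \<le> cluster_size delay l j \<omega>"
    unfolding cluster_size_def
    by (intro ecount_mono) (auto dest: cluster_in_cluster cluster_progenitor[THEN progenitor_ancestor])
  finally show ?thesis .
qed

lemma cluster_mono:
  "v \<le> v' \<Longrightarrow> n \<le> n' \<Longrightarrow> cluster v n e \<omega> \<subseteq> cluster v' n' e \<omega>"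
proof (induction n arbitrary: e n')
  case 0
  then show ?case by (cases n') auto
next
  case (Suc n)
  from Suc.prems obtain n'' where n': "n' = Suc n''" "n \<le> n''" by (cases n') auto
  have "points (delay e) {0<..real v} \<omega> \<subseteq> points (delay e) {0<..real v'} \<omega>"
    using Suc.prems(1) by (force simp: points_def)
  then show ?case
    using Suc.IH[OF Suc.prems(1) n'(2)] by (fastforce simp: n'(1))
qed

lemma cluster_step:
  "f \<in> cluster v n e \<omega> \<Longrightarrow> (m, k) \<in> points (delay f) {0<..real v} \<omega> \<Longrightarrow>
    Offspring f m k \<in> cluster v (Suc n) e \<omega>"
proof (induction n arbitrary: e)
  case 0
  then show ?case by force
next
  case (Suc n)
  then show ?case
    by (subst cluster.simps(2)) (fastforce simp del: cluster.simps(2) simp: cluster.simps(2)[of v n])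
qed

lemma event_time_pos: "\<omega> \<in> space M \<Longrightarrow> 0 < event_time imm delay e \<omega>"
  by (induction e) (auto simp: imm_pos delay_pos add_pos_pos)

text \<open>
  A finite event time is a finite sum of finite positive delays along the line of descent, so a
  sufficiently large truncation level retains the event; its immigrant arrived no later.
\<close>
lemma event_in_cluster:
  assumes \<omega>: "\<omega> \<in> space M"
  shows "event_time imm delay f \<omega> < \<infinity> \<Longrightarrow>
    (\<exists>n. f \<in> cluster n n (ancestor f) \<omega>) \<and> event_time imm delay (ancestor f) \<omega> \<le> event_time imm delay f \<omega>"
proof (induction f)
  case (Immigrant j k)
  have "Immigrant j k \<in> cluster 0 0 (Immigrant j k) \<omega>" by simp
  then show ?case by (auto simp del: cluster.simps)
next
  case (Offspring e m k)
  have pos: "0 < event_time imm delay e \<omega>" "0 < delay e m k \<omega>"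
    using \<omega> by (simp_all add: event_time_pos delay_pos)
  then have fin: "event_time imm delay e \<omega> < \<infinity>" "delay e m k \<omega> < \<infinity>"
    using Offspring.prems by auto
  then obtain d where d: "delay e m k \<omega> = ereal d" "0 < d"
    using pos by (cases "delay e m k \<omega>") auto
  from Offspring.IH[OF fin(1)] obtain n where n: "e \<in> cluster n n (ancestor e) \<omega>"
    and le: "event_time imm delay (ancestor e) \<omega> \<le> event_time imm delay e \<omega>" by blast
  define v where "v = max n (nat \<lceil>d\<rceil>)"
  have "e \<in> cluster v v (ancestor e) \<omega>"
    using cluster_mono[of n v n v] n by (auto simp: v_def)
  moreover have "(m, k) \<in> points (delay e) {0<..real v} \<omega>"
    using d by (auto simp: points_def v_def intro!: imageI) linarith
  ultimately have "Offspring e m k \<in> cluster v (Suc v) (ancestor e) \<omega>"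
    by (rule cluster_step)
  then have "Offspring e m k \<in> cluster (Suc v) (Suc v) (ancestor e) \<omega>"
    using cluster_mono[of v "Suc v" "Suc v" "Suc v"] by auto
  moreover have "event_time imm delay e \<omega> \<le> event_time imm delay e \<omega> + delay e m k \<omega>"
    using pos(2) by (simp add: ereal_le_add_self)
  ultimately show ?case
    using le by (auto simp del: cluster.simps intro: order_trans)
qed

definition cell :: "real \<Rightarrow> nat \<Rightarrow> real set" where
  "cell h k = {real k * h<..real (Suc k) * h}"

lemma cell_block:
  assumes "0 < h"
  shows "cell h k \<in> sets borel \<and> bounded (cell h k) \<and> cell h k \<subseteq> {0<..}"
proof -
  have "bounded (cell h k)"
    unfolding cell_def by (rule bounded_subset[OF bounded_closed_interval[of "real k * h" "real (Suc k) * h"]]) auto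
  moreover have "0 \<le> real k * h" using assms by simp
  ultimately show ?thesis unfolding cell_def by auto
qed

lemma disjoint_cells:
  assumes "0 < h" shows "disjoint_family_on (cell h) J"
proof -
  have "cell h a \<inter> cell h b = {}" if "a < b" for a b
  proof -
    have "real (Suc a) * h \<le> real b * h" using that assms by (intro mult_right_mono) auto
    then show ?thesis by (auto simp: cell_def simp del: of_nat_Suc)
  qed
  then show ?thesis
    unfolding disjoint_family_on_def by (metis Int_commute linorder_neqE_nat)
qed

lemma in_cell:
  assumes "0 < h" "0 < x" "x \<le> real k * h"
  shows "\<exists>q<k. x \<in> cell h q"
proof -
  define q where "q = nat (\<lceil>x / h\<rceil> - 1)"
  have pos: "1 \<le> \<lceil>x / h\<rceil>" using assms by simp
  then have q: "real q = real_of_int \<lceil>x / h\<rceil> - 1" by (simp add: q_def)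
  have "real q < x / h" "x / h \<le> real (Suc q)" using q by linarith+
  then have "x \<in> cell h q" using assms(1) by (simp add: cell_def field_simps)
  moreover have "x / h \<le> real k" using assms by (simp add: field_simps)
  then have "q < k" using \<open>real q < x / h\<close> by linarith
  ultimately show ?thesis by blast
qed

text \<open>
  The domination. Finitely many events up to time \<open>t\<close> all belong to truncated clusters, at a large
  enough level, of immigrants that arrived by time \<open>t\<close>, hence in one of the first cells of the grid.
\<close>
lemma hawkes_count_le_blocks:
  assumes \<omega>: "\<omega> \<in> space M" "locally_finite \<omega>" and a: "enat a \<le> hawkes_count imm delay j t \<omega>"
  shows "\<exists>n. \<forall>v\<ge>n. \<forall>h>0. \<forall>k. t \<le> real k * h \<longrightarrow> a \<le> (\<Sum>q<k. block v (cell h q) \<omega>) $ j"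
proof -
  let ?E = "{e. component e = j \<and> event_time imm delay e \<omega> \<in> {0<..ereal t}}"
  have "\<exists>F. F \<subseteq> ?E \<and> finite F \<and> card F = a"
  proof (cases "finite ?E")
    case True
    then have "a \<le> card ?E" using a by (simp add: hawkes_count_def ecount_def)
    then obtain F where "F \<subseteq> ?E" "card F = a" "finite F" by (rule obtain_subset_with_card_n)
    then show ?thesis by blast
  next
    case False
    then show ?thesis using infinite_arbitrarily_large by blast
  qed
  then obtain F where F: "F \<subseteq> ?E" "finite F" "card F = a" by blast
  have "\<forall>f\<in>F. \<exists>n. f \<in> cluster n n (ancestor f) \<omega>"
  proof
    fix f assume "f \<in> F"
    then have "event_time imm delay f \<omega> < \<infinity>" using F(1) by (auto intro: le_less_trans)
    then show "\<exists>n. f \<in> cluster n n (ancestor f) \<omega>" using event_in_cluster[OF \<omega>(1)] by blast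
  qed
  then obtain n where n: "\<forall>f\<in>F. f \<in> cluster (n f) (n f) (ancestor f) \<omega>" by metis
  define n0 where "n0 = Max (insert 0 (n ` F))"
  have "a \<le> (\<Sum>q<k. block v (cell h q) \<omega>) $ j"
    if v: "n0 \<le> v" and h: "0 < h" and k: "t \<le> real k * h" for v h k
  proof -
    let ?S = "\<lambda>p. {f\<in>cluster v v (Immigrant (fst p) (snd p)) \<omega>. component f = j}"
    have "F \<subseteq> (\<Union>q\<in>{..<k}. \<Union>p\<in>points imm (cell h q) \<omega>. ?S p)"
    proof
      fix f assume f: "f \<in> F"
      then have "n f \<le> v" using v F(2) by (auto simp: n0_def)
      then have fc: "f \<in> cluster v v (ancestor f) \<omega>"
        using n f cluster_mono[of "n f" v "n f" v] by blast
      obtain m q where anc: "ancestor f = Immigrant m q"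
        by (induction f) auto
      have ft: "component f = j" "event_time imm delay f \<omega> \<le> ereal t"
        using F(1) f by auto
      then have "event_time imm delay f \<omega> < \<infinity>" by (auto intro: le_less_trans)
      from event_in_cluster[OF \<omega>(1) this] have "imm m q \<omega> \<le> ereal t"
        using ft(2) by (auto simp: anc intro: order_trans)
      then obtain x where x: "imm m q \<omega> = ereal x" "0 < x" "x \<le> t"
        using imm_pos[OF \<omega>(1), of m q] by (cases "imm m q \<omega>") auto
      then obtain b where "b < k" "x \<in> cell h b"
        using in_cell[OF h x(2), of k] k by auto
      then have "(m, q) \<in> points imm (cell h b) \<omega>" "f \<in> ?S (m, q)"
        using x(1) fc ft(1) by (auto simp: points_def anc)
      then show "f \<in> (\<Union>q\<in>{..<k}. \<Union>p\<in>points imm (cell h q) \<omega>. ?S p)"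
        using \<open>b < k\<close> by blast
    qed
    moreover have finp: "finite (points imm (cell h q) \<omega>)" for q
    proof -
      have "points imm (cell h q) \<omega> \<subseteq> points imm {0<..real (nat \<lceil>real (Suc q) * h\<rceil>)} \<omega>"
        using cell_block[OF h, of q] unfolding points_def cell_def
        by (fastforce simp del: of_nat_Suc intro: order_trans[OF _ real_nat_ceiling_ge])
      then show ?thesis using \<omega>(2) finite_subset by (auto simp: locally_finite_def)
    qed
    moreover have finS: "finite (?S p)" for p
      using progeny_eq_card[OF \<omega>(2)] by auto
    ultimately have "card F \<le> card (\<Union>q\<in>{..<k}. \<Union>p\<in>points imm (cell h q) \<omega>. ?S p)"
      by (intro card_mono) auto
    also have "\<dots> \<le> (\<Sum>q<k. card (\<Union>p\<in>points imm (cell h q) \<omega>. ?S p))"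
      by (rule card_UN_le) auto
    also have "\<dots> \<le> (\<Sum>q<k. \<Sum>p\<in>points imm (cell h q) \<omega>. card (?S p))"
      by (intro sum_mono card_UN_le finp)
    also have "\<dots> = (\<Sum>q<k. block v (cell h q) \<omega>) $ j"
      using progeny_eq_card[OF \<omega>(2)] by (simp add: block_def sum_component)
    finally show ?thesis using F(3) by simp
  qed
  then show ?thesis by blast
qed

end


context compound_hawkes
begin

section \<open>Exponential moments and the adjustment equation\<close>

lemma claim_mgf: "(\<integral>\<^sup>+\<omega>. ennreal (exp (\<theta> * claim l q \<omega> $ i)) \<partial>M) = mgf_comp U i l \<theta>"
  unfolding mgf_comp_def claim_law[of l q, symmetric]
  by (subst nn_integral_distr) auto

lemma AE_claim_nonneg: "AE \<omega> in M. \<forall>l q. 0 \<le> claim l q \<omega> $ i"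
proof -
  have "AE \<omega> in M. 0 \<le> claim l q \<omega> $ i" for l q
  proof -
    have "AE v in distr M borel (claim l q). \<forall>i. 0 \<le> v $ i"
      using U_nonneg[of l] unfolding claim_law .
    then have "AE \<omega> in M. \<forall>i. 0 \<le> claim l q \<omega> $ i" by (subst (asm) AE_distr_iff) auto
    then show ?thesis by eventually_elim simp
  qed
  then show ?thesis by (simp add: AE_all_countable)
qed

lemma mgf_comp_ge_1:
  assumes "0 < \<theta>" shows "1 \<le> mgf_comp U i l \<theta>"
proof -
  have "(\<integral>\<^sup>+\<omega>. 1 \<partial>M) \<le> (\<integral>\<^sup>+\<omega>. ennreal (exp (\<theta> * claim l 0 \<omega> $ i)) \<partial>M)"
    using AE_claim_nonneg[of i] assms by (intro nn_integral_mono_AE) (auto elim!: eventually_mono)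
  then show ?thesis by (simp add: claim_mgf emeasure_space_1)
qed

definition cluster_mgf :: "'s \<Rightarrow> real \<Rightarrow> 'd \<Rightarrow> ennreal" where
  "cluster_mgf i \<theta> j =
    (\<integral>\<^sup>+\<omega>. (\<Prod>l\<in>UNIV. epower (mgf_comp U i l \<theta>) (cluster_size delay l j \<omega>)) \<partial>M)"

lemma progeny_mgf_le:
  assumes "0 < \<theta>"
  shows "(\<integral>\<^sup>+\<omega>. (\<Prod>l\<in>UNIV. mgf_comp U i l \<theta> ^ (progeny v n (Immigrant j 0) \<omega> $ l)) \<partial>M)
    \<le> cluster_mgf i \<theta> j"
  unfolding cluster_mgf_def
  using AE_locally_finite
  by (intro nn_integral_mono_AE)
     (auto elim!: eventually_mono
       intro!: prod_mono_ennreal power_le_epower mgf_comp_ge_1 assms progeny_le_cluster_size)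

lemma cluster_mgf_ge_1:
  assumes "0 < \<theta>" shows "1 \<le> cluster_mgf i \<theta> j"
proof -
  have "(\<integral>\<^sup>+\<omega>. 1 \<partial>M) \<le>
      (\<integral>\<^sup>+\<omega>. (\<Prod>l\<in>UNIV. mgf_comp U i l \<theta> ^ (progeny 0 0 (Immigrant j 0) \<omega> $ l)) \<partial>M)"
    using mgf_comp_ge_1[OF assms] by (intro nn_integral_mono prod_ge_1 one_le_power) auto
  also have "\<dots> \<le> cluster_mgf i \<theta> j" by (rule progeny_mgf_le[OF assms])
  finally show ?thesis by (simp add: emeasure_space_1)
qed

text \<open>
  The terms of \<open>\<Lambda>\<close> are non-negative since cluster moments are at least 1, so finiteness of the
  sum forces finiteness of each term; a component with base rate 0 contributes 0 even if its cluster
  moment is infinite.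
\<close>
lemma adjustment_equation:
  assumes \<theta>: "0 < \<theta>" and Psi: "Psi M base U delay r i \<theta> = 0"
  shows "\<And>j. 0 < base $ j \<Longrightarrow> cluster_mgf i \<theta> j < \<infinity>"
    and "(\<Sum>j\<in>UNIV. base $ j * (enn2real (cluster_mgf i \<theta> j) - 1)) = r * \<theta>"
proof -
  let ?T = "\<lambda>j. ereal (base $ j) * (enn2ereal (cluster_mgf i \<theta> j) - 1)"
  have "x - ereal c = 0 \<Longrightarrow> x = ereal c" for x :: ereal and c by (cases x) auto
  from this[OF Psi[unfolded Psi_def]]
  have L: "(\<Sum>j\<in>UNIV. ?T j) = ereal (r * \<theta>)"
    by (simp only: Lambda_def cluster_mgf_def)
  have ge: "1 \<le> enn2ereal (cluster_mgf i \<theta> j)" for j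
    using cluster_mgf_ge_1[OF \<theta>, of i j] by (simp add: less_eq_ennreal.rep_eq one_ennreal.rep_eq)
  have nn: "0 \<le> ?T j" for j
    using ge[of j] base_nonneg[of j] by (intro ereal_0_le_mult ereal_diff_positive) auto
  show fin: "cluster_mgf i \<theta> j < \<infinity>" if "0 < base $ j" for j
  proof (rule ccontr)
    assume "\<not> cluster_mgf i \<theta> j < \<infinity>"
    then have "cluster_mgf i \<theta> j = \<top>" by (simp add: not_less top_unique)
    then have "enn2ereal (cluster_mgf i \<theta> j) = \<infinity>" by simp
    then have inf: "?T j = \<infinity>" using that by (simp add: one_ereal_def)
    have "?T j \<le> (\<Sum>j\<in>UNIV. ?T j)" using nn by (intro sum_nonneg_leq_bound[OF _ _ refl]) auto
    from this[unfolded inf L] show False by simp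
  qed
  have T: "?T j = ereal (base $ j * (enn2real (cluster_mgf i \<theta> j) - 1))" for j
  proof (cases "base $ j = 0")
    case False
    then have "0 < base $ j" using base_nonneg[of j] by (simp add: order.strict_iff_order)
    then have "cluster_mgf i \<theta> j < \<top>" using fin by simp
    then have "enn2ereal (cluster_mgf i \<theta> j) = ereal (enn2real (cluster_mgf i \<theta> j))"
      by (cases "cluster_mgf i \<theta> j") (auto simp: enn2ereal_ennreal)
    then show ?thesis by (simp add: one_ereal_def)
  qed (simp add: zero_ereal_def[symmetric])
  have "ereal (\<Sum>j\<in>UNIV. base $ j * (enn2real (cluster_mgf i \<theta> j) - 1)) = ereal (r * \<theta>)"
    using L unfolding T by simp
  then show "(\<Sum>j\<in>UNIV. base $ j * (enn2real (cluster_mgf i \<theta> j) - 1)) = r * \<theta>" by simp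
qed

text \<open>
  Truncation only decreases the cluster moments, so the exponent is at most \<open>h * \<Lambda>\<close>, which
  equals \<open>\<theta> * r * h\<close> by the adjustment equation.
\<close>
lemma block_mgf_le:
  assumes \<theta>: "0 < \<theta>" and Psi: "Psi M base U delay r i \<theta> = 0" and h: "0 < h"
  shows "(\<integral>\<^sup>+\<omega>. (\<Prod>l\<in>UNIV. mgf_comp U i l \<theta> ^ (block v (cell h k) \<omega> $ l)) \<partial>M)
    \<le> ennreal (exp (\<theta> * r * h))"
proof -
  let ?G = "cluster_mgf i \<theta>"
  have len: "(LBINT s:cell h k. base $ m) = h * base $ m" for m
    using h by (simp add: cell_def LBINT_const algebra_simps)
  have "(\<integral>\<^sup>+\<omega>. (\<Prod>l\<in>UNIV. mgf_comp U i l \<theta> ^ (block v (cell h k) \<omega> $ l)) \<partial>M)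
      = (\<Prod>m\<in>UNIV. \<integral>\<^sup>+q. ennreal (poisson_weight (h * base $ m) q) *
        (\<integral>\<^sup>+\<omega>. (\<Prod>l\<in>UNIV. mgf_comp U i l \<theta> ^ (progeny v v (Immigrant m 0) \<omega> $ l)) \<partial>M) ^ q \<partial>count_space UNIV)"
    using cell_block[OF h, of k] by (subst block_generating_function) (auto simp: len)
  also have "\<dots> \<le> (\<Prod>m\<in>UNIV. ennreal (exp (h * base $ m * (enn2real (?G m) - 1))))"
  proof (intro prod_mono_ennreal)
    fix m
    have "(\<integral>\<^sup>+q. ennreal (poisson_weight (h * base $ m) q) *
        (\<integral>\<^sup>+\<omega>. (\<Prod>l\<in>UNIV. mgf_comp U i l \<theta> ^ (progeny v v (Immigrant m 0) \<omega> $ l)) \<partial>M) ^ q \<partial>count_space UNIV)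
      \<le> (\<integral>\<^sup>+q. ennreal (poisson_weight (h * base $ m) q) * ?G m ^ q \<partial>count_space UNIV)"
      by (intro nn_integral_mono mult_left_mono power_mono progeny_mgf_le \<theta>) auto
    also have "\<dots> = ennreal (exp (h * base $ m * (enn2real (?G m) - 1)))"
    proof (cases "base $ m = 0")
      case True
      then show ?thesis by (simp add: poisson_transform_0)
    next
      case False
      then have "0 < base $ m" using base_nonneg[of m] by (simp add: order.strict_iff_order)
      then have "?G m = ennreal (enn2real (?G m))"
        using adjustment_equation(1)[OF \<theta> Psi] by simp
      then show ?thesis
        using poisson_transform[of "h * base $ m" "enn2real (?G m)"] h base_nonneg[of m] by simp
    qed
    finally show "(\<integral>\<^sup>+q. ennreal (poisson_weight (h * base $ m) q) *
        (\<integral>\<^sup>+\<omega>. (\<Prod>l\<in>UNIV. mgf_comp U i l \<theta> ^ (progeny v v (Immigrant m 0) \<omega> $ l)) \<partial>M) ^ q \<partial>count_space UNIV)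
      \<le> ennreal (exp (h * base $ m * (enn2real (?G m) - 1)))" .
  qed
  also have "\<dots> = ennreal (exp (\<Sum>m\<in>UNIV. h * (base $ m * (enn2real (?G m) - 1))))"
    by (simp add: prod_ennreal exp_sum mult.assoc)
  also have "(\<Sum>m\<in>UNIV. h * (base $ m * (enn2real (?G m) - 1))) = \<theta> * r * h"
    unfolding sum_distrib_left[symmetric] adjustment_equation(2)[OF \<theta> Psi] by simp
  finally show ?thesis .
qed

definition total_claim :: "'s \<Rightarrow> nat ^ 'd \<Rightarrow> 'w \<Rightarrow> real" where
  "total_claim i a \<omega> = (\<Sum>l\<in>UNIV. \<Sum>q<a $ l. claim l q \<omega> $ i)"

definition claims_below :: "nat ^ 'd \<Rightarrow> 'd source set" where
  "claims_below a = {Claim l q |l q. q < a $ l}"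

lemma measurable_total_claim_info:
  "a \<le> b \<Longrightarrow> total_claim i a \<in> borel_measurable (info i (claims_below b))"
  unfolding total_claim_def[abs_def]
  by (intro borel_measurable_sum measurable_claim_info)
     (auto simp: claims_below_def less_eq_vec_def intro: less_le_trans)

definition cumulative :: "(nat \<Rightarrow> nat ^ 'd) \<Rightarrow> nat \<Rightarrow> nat ^ 'd" where
  "cumulative d k = (\<Sum>q<k. d q)"

lemma cumulative_Suc: "cumulative d (Suc k) = cumulative d k + d k"
  by (simp add: cumulative_def)

lemma cumulative_mono: "j \<le> k \<Longrightarrow> cumulative d j \<le> cumulative d k"
  unfolding cumulative_def less_eq_vec_def sum_component
  by (intro allI sum_mono2) auto

lemma cumulative_cong: "j \<le> k \<Longrightarrow> cumulative (restrict d {..<k}) j = cumulative d j"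
  unfolding cumulative_def by (intro sum.cong) auto

lemma total_claim_add:
  "total_claim i (a + b) \<omega> = total_claim i a \<omega> + (\<Sum>(l, q)\<in>(SIGMA l:UNIV. {a $ l..<(a + b) $ l}). claim l q \<omega> $ i)"
proof -
  have "(\<Sum>q<(a + b) $ l. claim l q \<omega> $ i)
      = (\<Sum>q<a $ l. claim l q \<omega> $ i) + (\<Sum>q\<in>{a $ l..<(a + b) $ l}. claim l q \<omega> $ i)" for l
    using sum.atLeastLessThan_concat[of 0 "a $ l" "(a + b) $ l" "\<lambda>q. claim l q \<omega> $ i"]
    by (simp add: atLeast0LessThan)
  then show ?thesis
    by (simp add: total_claim_def sum.distrib sum.Sigma)
qed

lemma nn_integral_new_claims:
  "(\<integral>\<^sup>+\<omega>. ennreal (exp (\<theta> * (\<Sum>(l, q)\<in>(SIGMA l:UNIV. {a $ l..<(a + b) $ l}). claim l q \<omega> $ i))) \<partial>M)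
    = (\<Prod>l\<in>UNIV. mgf_comp U i l \<theta> ^ (b $ l))"
proof -
  let ?S = "SIGMA l:UNIV. {a $ l..<(a + b) $ l}"
  let ?X = "\<lambda>p \<omega>. ennreal (exp (\<theta> * claim (fst p) (snd p) \<omega> $ i))"
  have ind: "indep_vars (\<lambda>_. borel) ?X ?S"
  proof (rule indep_vars_info)
    show "disjoint_family_on (\<lambda>p. {Claim (fst p) (snd p)} :: 'd source set) ?S"
      by (auto simp: disjoint_family_on_def)
    fix p
    have "(\<lambda>\<omega>. claim (fst p) (snd p) \<omega> $ i) \<in> borel_measurable (info i {Claim (fst p) (snd p)})"
      by (rule measurable_claim_info) simp
    from measurable_compose[OF this, of "\<lambda>x. ennreal (exp (\<theta> * x))" borel]
    show "?X p \<in> borel_measurable (info i {Claim (fst p) (snd p)})" by simp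
  qed
  have "(\<integral>\<^sup>+\<omega>. ennreal (exp (\<theta> * (\<Sum>(l, q)\<in>?S. claim l q \<omega> $ i))) \<partial>M) = (\<integral>\<^sup>+\<omega>. (\<Prod>p\<in>?S. ?X p \<omega>) \<partial>M)"
    by (simp add: sum_distrib_left exp_sum prod_ennreal case_prod_beta)
  also have "\<dots> = (\<Prod>p\<in>?S. \<integral>\<^sup>+\<omega>. ?X p \<omega> \<partial>M)"
    using ind by (intro indep_vars_nn_integral) auto
  also have "\<dots> = (\<Prod>(l, q)\<in>?S. mgf_comp U i l \<theta>)"
    by (simp add: claim_mgf case_prod_beta)
  also have "\<dots> = (\<Prod>l\<in>UNIV. \<Prod>q\<in>{a $ l..<(a + b) $ l}. mgf_comp U i l \<theta>)"
    by (rule prod.Sigma[symmetric]) auto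
  finally show ?thesis by simp
qed

lemma measurable_new_claims_info:
  "(\<lambda>\<omega>. \<Sum>(l, q)\<in>(SIGMA l:UNIV. {a $ l..<(a + b) $ l}). claim l q \<omega> $ i)
    \<in> borel_measurable (info i (range (case_prod Claim) - claims_below a))"
  by (intro borel_measurable_sum) (auto simp: claims_below_def intro!: measurable_claim_info)

end


context compound_hawkes
begin

section \<open>The supermartingale on a grid\<close>

text \<open>
  Extensional, hence one of countably many values; this is what permits freezing the path.
\<close>
definition block_path :: "nat \<Rightarrow> real \<Rightarrow> nat \<Rightarrow> 'w \<Rightarrow> nat \<Rightarrow> nat ^ 'd" where
  "block_path v h k \<omega> = (\<lambda>q\<in>{..<k}. block v (cell h q) \<omega>)"

definition solvent :: "'s \<Rightarrow> real \<Rightarrow> real \<Rightarrow> real \<Rightarrow> nat \<Rightarrow> (nat \<Rightarrow> nat ^ 'd) \<Rightarrow> 'w \<Rightarrow> bool" where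
  "solvent i r h u k d \<omega> \<longleftrightarrow> (\<forall>j\<le>k. total_claim i (cumulative d j) \<omega> \<le> u + r * (real j * h))"

text \<open>
  The exponential supermartingale, as a function of a frozen path of event numbers.
\<close>
definition growth :: "'s \<Rightarrow> real \<Rightarrow> real \<Rightarrow> real \<Rightarrow> nat \<Rightarrow> (nat \<Rightarrow> nat ^ 'd) \<Rightarrow> 'w \<Rightarrow> ennreal" where
  "growth i \<theta> r h k d \<omega> = ennreal (exp (\<theta> * (total_claim i (cumulative d k) \<omega> - r * (real k * h))))"

lemma solvent_cong: "solvent i r h u k (restrict d {..<k}) \<omega> \<longleftrightarrow> solvent i r h u k d \<omega>"
  by (simp add: solvent_def cumulative_cong)

lemma growth_cong: "growth i \<theta> r h k (restrict d {..<k}) \<omega> = growth i \<theta> r h k d \<omega>"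
  by (simp add: growth_def cumulative_cong)

lemma path_restrict: "block_path v h k \<omega> = restrict (block_path v h (Suc k) \<omega>) {..<k}"
  by (auto simp: block_path_def fun_eq_iff)

lemma measurable_solvent_growth:
  "(\<lambda>\<omega>. indicator {\<omega>. solvent i r h u k d \<omega>} \<omega> * growth i \<theta> r h k d \<omega>)
    \<in> borel_measurable (info i (claims_below (cumulative d k)))"
proof -
  have [measurable]: "total_claim i (cumulative d j) \<in> borel_measurable (info i (claims_below (cumulative d k)))" if "j \<le> k" for j
    using that by (intro measurable_total_claim_info cumulative_mono)
  have [measurable]: "Measurable.pred (info i (claims_below (cumulative d k))) (\<lambda>\<omega>. solvent i r h u k d \<omega>)"
  proof -
    have "Measurable.pred (info i (claims_below (cumulative d k)))
        (\<lambda>\<omega>. total_claim i (cumulative d j) \<omega> \<le> u + r * (real j * h))" if "j \<le> k" for j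
      using that by measurable
    then have "Measurable.pred (info i (claims_below (cumulative d k)))
        (\<lambda>\<omega>. \<forall>j\<in>{..k}. total_claim i (cumulative d j) \<omega> \<le> u + r * (real j * h))"
      by (intro pred_intros_finite) auto
    then show ?thesis by (simp add: solvent_def)
  qed
  show ?thesis
    unfolding growth_def by measurable
qed

lemma countable_paths: "countable ({..<k::nat} \<rightarrow>\<^sub>E (UNIV :: (nat ^ 'd) set))"
  by (intro countable_PiE) auto

lemma measurable_path_info:
  assumes h: "0 < h"
  shows "block_path v h k \<in> measurable (info i (insert Immigration (range Reproduction)))
    (count_space ({..<k} \<rightarrow>\<^sub>E UNIV))"
proof -
  have "(\<Pi>\<^sub>M q\<in>{..<k}. count_space (UNIV :: (nat ^ 'd) set)) = count_space ({..<k} \<rightarrow>\<^sub>E UNIV)"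
    by (rule count_space_PiM_finite) auto
  moreover have "block_path v h k \<in> measurable (info i (insert Immigration (range Reproduction)))
      (\<Pi>\<^sub>M q\<in>{..<k}. count_space UNIV)"
    unfolding block_path_def using cell_block[OF h] by (intro measurable_restrict measurable_block_info) auto
  ultimately show ?thesis by simp
qed

lemma freeze_path:
  assumes h: "0 < h" and F: "\<And>c. F c \<in> borel_measurable (info i (range (case_prod Claim)))"
  shows "(\<integral>\<^sup>+\<omega>. F (block_path v h k \<omega>) \<omega> \<partial>M) = (\<integral>\<^sup>+\<omega>'. \<integral>\<^sup>+\<omega>. F (block_path v h k \<omega>') \<omega> \<partial>M \<partial>M)"
  by (rule nn_integral_freeze_info[OF _ countable_paths measurable_path_info[OF h] F]) auto

lemma claims_below_subset: "claims_below a \<subseteq> range (case_prod Claim)"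
  by (auto simp: claims_below_def image_iff)

text \<open>
  With the path of event numbers frozen, the claims of the new events are independent of the earlier
  claims and integrate to \<open>\<Prod>l. m\<^sub>l ^ increment\<^sub>l\<close>. The increment is independent of the earlier
  path, and its transform is at most the factor removed by the premium income of one cell.
\<close>
lemma growth_supermartingale:
  assumes \<theta>: "0 < \<theta>" and Psi: "Psi M base U delay r i \<theta> = 0" and h: "0 < h"
  shows "(\<integral>\<^sup>+\<omega>. indicator {\<omega>. solvent i r h u k (block_path v h (Suc k) \<omega>) \<omega>} \<omega>
        * growth i \<theta> r h (Suc k) (block_path v h (Suc k) \<omega>) \<omega> \<partial>M)
    \<le> (\<integral>\<^sup>+\<omega>. indicator {\<omega>. solvent i r h u k (block_path v h k \<omega>) \<omega>} \<omega> * growth i \<theta> r h k (block_path v h k \<omega>) \<omega> \<partial>M)"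
proof -
  define F where "F d \<omega> = indicator {\<omega>. solvent i r h u k d \<omega>} \<omega> * growth i \<theta> r h k d \<omega>" for d \<omega>
  define \<Phi> where "\<Phi> d = (\<integral>\<^sup>+\<omega>. F d \<omega> \<partial>M)" for d
  define \<zeta> where "\<zeta> x = (\<Prod>l\<in>UNIV. mgf_comp U i l \<theta> ^ (x $ l))" for x :: "nat ^ 'd"
  define \<eta> where "\<eta> d \<omega> = ennreal (exp (\<theta> *
      (\<Sum>(l, q)\<in>(SIGMA l:UNIV. {cumulative d k $ l..<(cumulative d k + d k) $ l}). claim l q \<omega> $ i)))" for d \<omega>
  let ?e = "ennreal (exp (- (\<theta> * r * h)))"
  have F_cong: "F (restrict d {..<k}) \<omega> = F d \<omega>" for d \<omega>
    by (simp add: F_def solvent_cong growth_cong)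
  have \<Phi>_cong: "\<Phi> (restrict d {..<k}) = \<Phi> d" for d
    by (simp add: \<Phi>_def F_cong)
  have F_meas: "F d \<in> borel_measurable (info i (claims_below (cumulative d k)))" for d
    unfolding F_def[abs_def] by (rule measurable_solvent_growth)
  have \<eta>_meas: "\<eta> d \<in> borel_measurable (info i (range (case_prod Claim) - claims_below (cumulative d k)))" for d
    unfolding \<eta>_def[abs_def]
    by (rule measurable_compose[OF measurable_new_claims_info[of i "cumulative d k" "d k"],
        of "\<lambda>x. ennreal (exp (\<theta> * x))" borel]) simp
  have split: "growth i \<theta> r h (Suc k) d \<omega> = growth i \<theta> r h k d \<omega> * \<eta> d \<omega> * ?e" for d \<omega>
    unfolding growth_def \<eta>_def cumulative_Suc total_claim_add
    by (simp add: algebra_simps flip: ennreal_mult exp_add)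
  have F_claims: "F d \<in> borel_measurable (info i (range (case_prod Claim)))" for d
    by (rule measurable_info_mono[OF claims_below_subset F_meas])
  have \<eta>_claims: "\<eta> d \<in> borel_measurable (info i (range (case_prod Claim)))" for d
    by (rule measurable_info_mono[OF Diff_subset \<eta>_meas])
  have FM: "F d \<in> borel_measurable M" and \<eta>M: "\<eta> d \<in> borel_measurable M" for d
    using F_claims \<eta>_claims by (blast intro: measurable_info)+
  have inner: "(\<integral>\<^sup>+\<omega>. F d \<omega> * \<eta> d \<omega> * ?e \<partial>M) = \<Phi> d * \<zeta> (d k) * ?e" for d
  proof -
    have "indep_var borel (F d) borel (\<eta> d)"
      by (rule indep_var_info[OF _ F_meas \<eta>_meas]) auto
    then have "(\<integral>\<^sup>+\<omega>. F d \<omega> * \<eta> d \<omega> \<partial>M) = \<Phi> d * (\<integral>\<^sup>+\<omega>. \<eta> d \<omega> \<partial>M)"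
      unfolding \<Phi>_def by (rule nn_integral_indep_product)
    moreover have "(\<integral>\<^sup>+\<omega>. \<eta> d \<omega> \<partial>M) = \<zeta> (d k)"
      unfolding \<eta>_def \<zeta>_def by (rule nn_integral_new_claims)
    moreover have "(\<integral>\<^sup>+\<omega>. F d \<omega> * \<eta> d \<omega> * ?e \<partial>M) = (\<integral>\<^sup>+\<omega>. F d \<omega> * \<eta> d \<omega> \<partial>M) * ?e"
      using FM \<eta>M by (intro nn_integral_multc) measurable
    ultimately show ?thesis by simp
  qed
  have "(\<integral>\<^sup>+\<omega>. indicator {\<omega>. solvent i r h u k (block_path v h (Suc k) \<omega>) \<omega>} \<omega>
        * growth i \<theta> r h (Suc k) (block_path v h (Suc k) \<omega>) \<omega> \<partial>M)
      = (\<integral>\<^sup>+\<omega>. F (block_path v h (Suc k) \<omega>) \<omega> * \<eta> (block_path v h (Suc k) \<omega>) \<omega> * ?e \<partial>M)"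
    unfolding split F_def by (intro nn_integral_cong) (auto simp: mult.assoc split: split_indicator)
  also have "\<dots> = (\<integral>\<^sup>+\<omega>'. \<integral>\<^sup>+\<omega>. F (block_path v h (Suc k) \<omega>') \<omega> * \<eta> (block_path v h (Suc k) \<omega>') \<omega> * ?e \<partial>M \<partial>M)"
    by (rule freeze_path[OF h, of "\<lambda>d \<omega>. F d \<omega> * \<eta> d \<omega> * ?e" i])
       (use F_claims \<eta>_claims in measurable)
  also have "\<dots> = (\<integral>\<^sup>+\<omega>. \<Phi> (block_path v h k \<omega>) * \<zeta> (block v (cell h k) \<omega>) * ?e \<partial>M)"
    unfolding inner path_restrict[of v h k] \<Phi>_cong by (simp add: block_path_def)
  also have "\<dots> = (\<integral>\<^sup>+\<omega>. \<Phi> (block_path v h k \<omega>) \<partial>M) * (\<integral>\<^sup>+\<omega>. \<zeta> (block v (cell h k) \<omega>) \<partial>M) * ?e"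
  proof -
    have ind: "indep_vars (\<lambda>_. count_space UNIV) (\<lambda>q. block v (cell h q)) {..<Suc k}"
      by (rule indep_vars_block[OF cell_block[OF h] disjoint_cells[OF h]]) auto
    have PiM: "(\<Pi>\<^sub>M q\<in>{..<k}. count_space (UNIV :: (nat ^ 'd) set)) = count_space ({..<k} \<rightarrow>\<^sub>E UNIV)"
      by (rule count_space_PiM_finite) auto
    have "indep_var borel (\<Phi> \<circ> (\<lambda>\<omega>. \<lambda>q\<in>{..<k}. block v (cell h q) \<omega>))
        borel ((\<lambda>x. \<zeta> (x k)) \<circ> (\<lambda>\<omega>. \<lambda>q\<in>{k}. block v (cell h q) \<omega>))"
    proof (rule indep_var_compose[OF indep_var_restrict[OF ind]])
      show "\<Phi> \<in> borel_measurable (\<Pi>\<^sub>M q\<in>{..<k}. count_space UNIV)"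
        unfolding PiM by simp
      show "(\<lambda>x. \<zeta> (x k)) \<in> borel_measurable (\<Pi>\<^sub>M q\<in>{k}. count_space UNIV)"
        by (rule measurable_compose[OF measurable_component_singleton]) auto
    qed auto
    then have ind2: "indep_var borel (\<lambda>\<omega>. \<Phi> (block_path v h k \<omega>)) borel (\<lambda>\<omega>. \<zeta> (block v (cell h k) \<omega>))"
      by (simp add: comp_def block_path_def)
    show ?thesis
      unfolding nn_integral_indep_product[OF ind2, symmetric]
      using indep_var_rv1[OF ind2] indep_var_rv2[OF ind2] by (intro nn_integral_multc) measurable
  qed
  also have "\<dots> \<le> (\<integral>\<^sup>+\<omega>. \<Phi> (block_path v h k \<omega>) \<partial>M) * ennreal (exp (\<theta> * r * h)) * ?e"
    unfolding \<zeta>_def by (intro mult_left_mono mult_right_mono block_mgf_le \<theta> Psi h) auto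
  also have "\<dots> = (\<integral>\<^sup>+\<omega>. \<Phi> (block_path v h k \<omega>) \<partial>M)"
    by (simp add: mult.assoc flip: ennreal_mult exp_add)
  also have "\<dots> = (\<integral>\<^sup>+\<omega>. F (block_path v h k \<omega>) \<omega> \<partial>M)"
    unfolding \<Phi>_def by (rule freeze_path[OF h F_claims, symmetric])
  finally show ?thesis by (simp add: F_def indicator_def)
qed

lemma sets_solvent:
  assumes h: "0 < h" shows "{\<omega>\<in>space M. solvent i r h u k (block_path v h k \<omega>) \<omega>} \<in> events"
proof -
  have "total_claim i a \<in> borel_measurable M" for a
    using measurable_total_claim_info[OF order_refl] by (rule measurable_info)
  note [measurable] = this measurable_info[OF measurable_path_info[OF h]]
  have "{\<omega>\<in>space M. solvent i r h u k (block_path v h k \<omega>) \<omega>}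
      = (\<Union>d\<in>{..<k} \<rightarrow>\<^sub>E UNIV. {\<omega>\<in>space M. block_path v h k \<omega> = d} \<inter> {\<omega>\<in>space M. solvent i r h u k d \<omega>})"
    by (auto simp: block_path_def)
  also have "\<dots> \<in> events"
  proof (rule sets.countable_UN''[OF countable_paths])
    fix d :: "nat \<Rightarrow> nat ^ 'd" assume d: "d \<in> {..<k} \<rightarrow>\<^sub>E UNIV"
    then have "block_path v h k -` {d} \<inter> space M \<in> events"
      by (intro measurable_sets[OF measurable_info[OF measurable_path_info[OF h]]]) auto
    then have "{\<omega>\<in>space M. block_path v h k \<omega> = d} \<in> events" by (simp add: vimage_def Int_def conj_commute)
    moreover have "{\<omega>\<in>space M. solvent i r h u k d \<omega>} \<in> events" unfolding solvent_def by measurable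
    ultimately show "{\<omega>\<in>space M. block_path v h k \<omega> = d} \<inter> {\<omega>\<in>space M. solvent i r h u k d \<omega>} \<in> events"
      by (rule sets.Int)
  qed
  finally show ?thesis .
qed

text \<open>
  The maximal inequality: the expectation of the process stopped at ruin, which is at least
  \<open>exp (\<theta> * u)\<close> on the ruin event, starts from 1 and does not increase.
\<close>
lemma discrete_lundberg:
  assumes \<theta>: "0 < \<theta>" and Psi: "Psi M base U delay r i \<theta> = 0" and h: "0 < h" and u: "0 < u"
  shows "prob {\<omega>\<in>space M. \<not> solvent i r h u k (block_path v h k \<omega>) \<omega>} \<le> exp (- \<theta> * u)"
proof -
  let ?A = "\<lambda>k \<omega>. solvent i r h u k (block_path v h k \<omega>) \<omega>"
  let ?G = "\<lambda>k \<omega>. growth i \<theta> r h k (block_path v h k \<omega>) \<omega>"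
  let ?c = "ennreal (exp (\<theta> * u))"
  \<comment> \<open>appending the next increment does not change the past\<close>
  have prev: "solvent i r h u k (block_path v h (Suc k) \<omega>) \<omega> \<longleftrightarrow> ?A k \<omega>" for k \<omega>
    using solvent_cong[of i r h u k "block_path v h (Suc k) \<omega>" \<omega>] by (simp flip: path_restrict)
  have A_Suc: "?A (Suc k) \<omega> \<longleftrightarrow> ?A k \<omega> \<and>
      total_claim i (cumulative (block_path v h (Suc k) \<omega>) (Suc k)) \<omega> \<le> u + r * (real (Suc k) * h)" for k \<omega>
    using prev[of k \<omega>] by (auto simp: solvent_def le_Suc_eq)
  have setsA [measurable]: "Measurable.pred M (?A k)" for k
    using sets_solvent[OF h] by (simp add: pred_def)
  have cmeas: "(\<lambda>\<omega>. ?c * indicator {\<omega>. \<not> ?A k \<omega>} \<omega>) \<in> borel_measurable M" for k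
    by measurable
  have Gmeas: "(\<lambda>\<omega>. indicator {\<omega>. ?A k \<omega>} \<omega> * ?G k \<omega>) \<in> borel_measurable M" for k
  proof -
    have "(\<lambda>\<omega>. growth i \<theta> r h k d \<omega>) \<in> borel_measurable M" for d
      unfolding growth_def using measurable_info[OF measurable_total_claim_info[OF order_refl]] by measurable
    then have "?G k \<in> borel_measurable M"
      by (rule measurable_compose_countable'[OF _ measurable_info[OF measurable_path_info[OF h]] countable_paths])
    then show ?thesis by measurable
  qed
  have "(\<integral>\<^sup>+\<omega>. ?c * indicator {\<omega>. \<not> ?A k \<omega>} \<omega> + indicator {\<omega>. ?A k \<omega>} \<omega> * ?G k \<omega> \<partial>M) \<le> 1" for k
  proof (induction k)
    case 0
    have "?A 0 \<omega>" "?G 0 \<omega> = 1" for \<omega>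
      using u by (simp_all add: solvent_def growth_def cumulative_def total_claim_def)
    then show ?case by (simp add: emeasure_space_1)
  next
    case (Suc k)
    let ?H = "\<lambda>\<omega>. indicator {\<omega>. ?A k \<omega>} \<omega> * ?G (Suc k) \<omega>"
    have "(\<integral>\<^sup>+\<omega>. ?c * indicator {\<omega>. \<not> ?A (Suc k) \<omega>} \<omega> + indicator {\<omega>. ?A (Suc k) \<omega>} \<omega> * ?G (Suc k) \<omega> \<partial>M)
        \<le> (\<integral>\<^sup>+\<omega>. ?c * indicator {\<omega>. \<not> ?A k \<omega>} \<omega> + ?H \<omega> \<partial>M)"
    proof (rule nn_integral_mono)
      fix \<omega>
      have "?c \<le> ?G (Suc k) \<omega>" if "?A k \<omega>" "\<not> ?A (Suc k) \<omega>"
      proof -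
        have "u \<le> total_claim i (cumulative (block_path v h (Suc k) \<omega>) (Suc k)) \<omega> - r * (real (Suc k) * h)"
          using that unfolding A_Suc by linarith
        then show ?thesis using \<theta> unfolding growth_def by (intro ennreal_leI) simp
      qed
      then show "?c * indicator {\<omega>. \<not> ?A (Suc k) \<omega>} \<omega> + indicator {\<omega>. ?A (Suc k) \<omega>} \<omega> * ?G (Suc k) \<omega>
          \<le> ?c * indicator {\<omega>. \<not> ?A k \<omega>} \<omega> + ?H \<omega>"
        using A_Suc[of k \<omega>] by (auto split: split_indicator)
    qed
    also have "\<dots> = (\<integral>\<^sup>+\<omega>. ?c * indicator {\<omega>. \<not> ?A k \<omega>} \<omega> \<partial>M) + (\<integral>\<^sup>+\<omega>. ?H \<omega> \<partial>M)"
    proof (rule nn_integral_add)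
      have "(\<lambda>\<omega>. growth i \<theta> r h (Suc k) d \<omega>) \<in> borel_measurable M" for d
        unfolding growth_def using measurable_info[OF measurable_total_claim_info[OF order_refl]] by measurable
      then have "?G (Suc k) \<in> borel_measurable M"
        by (rule measurable_compose_countable'[OF _ measurable_info[OF measurable_path_info[OF h]] countable_paths])
      then show "?H \<in> borel_measurable M" by measurable
    qed measurable
    also have "(\<integral>\<^sup>+\<omega>. ?H \<omega> \<partial>M) \<le> (\<integral>\<^sup>+\<omega>. indicator {\<omega>. ?A k \<omega>} \<omega> * ?G k \<omega> \<partial>M)"
      using growth_supermartingale[OF \<theta> Psi h, of u k v] by (simp add: prev)
    also have "(\<integral>\<^sup>+\<omega>. ?c * indicator {\<omega>. \<not> ?A k \<omega>} \<omega> \<partial>M) + (\<integral>\<^sup>+\<omega>. indicator {\<omega>. ?A k \<omega>} \<omega> * ?G k \<omega> \<partial>M)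
        = (\<integral>\<^sup>+\<omega>. ?c * indicator {\<omega>. \<not> ?A k \<omega>} \<omega> + indicator {\<omega>. ?A k \<omega>} \<omega> * ?G k \<omega> \<partial>M)"
      by (rule nn_integral_add[OF cmeas Gmeas, symmetric])
    also have "\<dots> \<le> 1" by (rule Suc.IH)
    finally show ?case by simp
  qed
  from this[of k] have "(\<integral>\<^sup>+\<omega>. ?c * indicator {\<omega>\<in>space M. \<not> ?A k \<omega>} \<omega> \<partial>M) \<le> 1"
    by (rule order_trans[rotated]) (auto intro!: nn_integral_mono split: split_indicator)
  moreover have S: "{\<omega>\<in>space M. \<not> ?A k \<omega>} \<in> events" by measurable
  ultimately have "?c * emeasure M {\<omega>\<in>space M. \<not> ?A k \<omega>} \<le> 1"
    by (simp add: nn_integral_cmult_indicator)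
  then have "exp (\<theta> * u) * prob {\<omega>\<in>space M. \<not> ?A k \<omega>} \<le> 1"
    by (simp add: emeasure_eq_measure flip: ennreal_mult ennreal_1)
  then show ?thesis by (simp add: exp_minus field_simps)
qed

end


context compound_hawkes
begin

section \<open>From the grid to continuous time\<close>

text \<open>
  A value below a series of non-negative terms is already exceeded by a partial sum; this
  also covers infinite event numbers.
\<close>
lemma compound_partial_sum:
  assumes "y < compound imm delay claim i t \<omega>"
  shows "\<exists>a :: 'd \<Rightarrow> nat. (\<forall>l. enat (a l) \<le> hawkes_count imm delay l t \<omega>) \<and>
    y < (\<Sum>l\<in>UNIV. \<Sum>q<a l. ennreal (claim l q \<omega> $ i))"
proof -
  let ?N = "\<lambda>l. hawkes_count imm delay l t \<omega>"
  let ?f = "\<lambda>l q. if enat q < ?N l then ennreal (claim l q \<omega> $ i) else 0"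
  have "(\<lambda>n. \<Sum>l\<in>UNIV. \<Sum>q<n. ?f l q) \<longlonglongrightarrow> compound imm delay claim i t \<omega>"
    unfolding compound_def by (intro tendsto_sum summable_LIMSEQ) simp
  from order_tendstoD(1)[OF this assms]
  obtain n where n: "y < (\<Sum>l\<in>UNIV. \<Sum>q<n. ?f l q)"
    by (auto simp: eventually_sequentially)
  define a where "a l = (case ?N l of enat N \<Rightarrow> min n N | \<infinity> \<Rightarrow> n)" for l
  have a: "enat (a l) \<le> ?N l" for l
    by (cases "?N l") (auto simp: a_def)
  have "(\<Sum>q<n. ?f l q) = (\<Sum>q<a l. ennreal (claim l q \<omega> $ i))" for l
  proof -
    have "{q. q < n \<and> enat q < ?N l} = {..<a l}"
      by (cases "?N l") (auto simp: a_def)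
    then show ?thesis
      by (simp add: sum.If_cases Int_def)
  qed
  then show ?thesis using n a by auto
qed

text \<open>
  Ruin at time \<open>t\<close> is caused by finitely many claims and leaves some slack. They are all counted at
  the first grid time after \<open>t\<close>, and for a small mesh the premium earned meanwhile is less than the
  slack.
\<close>
lemma ruin_discretised:
  assumes \<omega>: "\<omega> \<in> space M" "locally_finite \<omega>" "\<forall>l q. 0 \<le> claim l q \<omega> $ i"
    and r: "0 < r" and u: "0 < u" and ruin: "ruin_time imm delay claim r i u \<omega> < \<infinity>"
  shows "\<forall>\<^sub>F v in sequentially.
    \<not> solvent i r (1 / Suc v) u (Suc v * Suc v) (block_path v (1 / Suc v) (Suc v * Suc v) \<omega>) \<omega>"
proof -
  have "{t. 0 < t \<and> ereal u < net_process imm delay claim r i t \<omega>} \<noteq> {}"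
    using ruin by (intro notI) (simp add: ruin_time_def top_ereal_def)
  then obtain t where t: "0 < t" and net: "ereal u < net_process imm delay claim r i t \<omega>"
    by blast
  have pos: "0 < u + r * t" using t r u by (simp add: add_pos_pos)
  have "ereal (u + r * t) < enn2ereal (compound imm delay claim i t \<omega>)"
    using net unfolding net_process_def by (cases "enn2ereal (compound imm delay claim i t \<omega>)") auto
  then have "ennreal (u + r * t) < compound imm delay claim i t \<omega>"
    using pos by (simp add: less_ennreal.rep_eq enn2ereal_ennreal)
  from compound_partial_sum[OF this] obtain a :: "'d \<Rightarrow> nat"
    where a: "\<And>l. enat (a l) \<le> hawkes_count imm delay l t \<omega>"
      and big: "ennreal (u + r * t) < (\<Sum>l\<in>UNIV. \<Sum>q<a l. ennreal (claim l q \<omega> $ i))"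
    by blast
  define Y where "Y = (\<Sum>l\<in>UNIV. \<Sum>q<a l. claim l q \<omega> $ i)"
  have Y: "u + r * t < Y"
    using big \<omega>(3) pos by (simp add: Y_def sum_ennreal sum_nonneg ennreal_less_iff)
  have "\<exists>n. \<forall>l. \<forall>v\<ge>n l. \<forall>h>0. \<forall>k. t \<le> real k * h \<longrightarrow> a l \<le> (\<Sum>q<k. block v (cell h q) \<omega>) $ l"
    using hawkes_count_le_blocks[OF \<omega>(1,2) a] by (intro choice allI)
  then obtain n where n: "\<And>l v h k. n l \<le> v \<Longrightarrow> 0 < h \<Longrightarrow> t \<le> real k * h \<Longrightarrow>
      a l \<le> (\<Sum>q<k. block v (cell h q) \<omega>) $ l"
    by blast
  have "\<forall>\<^sub>F v in sequentially. \<forall>l. n l \<le> v"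
    by (simp add: eventually_all_finite eventually_ge_at_top)
  moreover have "\<forall>\<^sub>F v in sequentially. t + 1 < real v"
    using filterlim_real_sequentially by (auto simp: filterlim_at_top_dense)
  moreover have "\<forall>\<^sub>F v in sequentially. r / (Y - (u + r * t)) < real v"
    using filterlim_real_sequentially by (auto simp: filterlim_at_top_dense)
  ultimately show ?thesis
  proof eventually_elim
    case (elim v)
    define h where "h = 1 / real (Suc v)"
    have h: "0 < h" "h \<le> 1" by (simp_all add: h_def)
    \<comment> \<open>the first grid index at or after the ruin time\<close>
    define k where "k = nat \<lceil>t / h\<rceil>"
    have "0 < \<lceil>t / h\<rceil>" using t h by simp
    then have k: "t / h \<le> real k" "real k < t / h + 1" unfolding k_def by linarith+
    then have kt: "t \<le> real k * h" "real k * h < t + h"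
      using h by (simp_all add: field_simps)
    have "real k < real (Suc v) * real (Suc v)"
    proof -
      have "real k < (t + h) * real (Suc v)" using kt(2) h by (simp add: h_def field_simps)
      also have "\<dots> \<le> real (Suc v) * real (Suc v)" using elim h by (intro mult_right_mono) auto
      finally show ?thesis .
    qed
    then have kK: "k \<le> Suc v * Suc v"
      by (metis less_imp_le_nat of_nat_less_iff of_nat_mult)
    have "r < (Y - (u + r * t)) * real (Suc v)"
    proof -
      have "r < (Y - (u + r * t)) * real v" using elim(3) Y by (simp add: field_simps)
      also have "\<dots> \<le> (Y - (u + r * t)) * real (Suc v)" using Y by (intro mult_left_mono) auto
      finally show ?thesis .
    qed
    then have "r * h < Y - (u + r * t)" by (simp add: h_def field_simps)
    moreover have "r * (real k * h) < r * (t + h)" using kt r by simp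
    ultimately have "u + r * (real k * h) < Y" by (simp add: algebra_simps)
    also have "Y \<le> total_claim i (cumulative (block_path v h (Suc v * Suc v) \<omega>) k) \<omega>"
    proof -
      have "cumulative (block_path v h (Suc v * Suc v) \<omega>) k = (\<Sum>q<k. block v (cell h q) \<omega>)"
        using kK by (auto simp: cumulative_def block_path_def intro!: sum.cong)
      then have "a l \<le> cumulative (block_path v h (Suc v * Suc v) \<omega>) k $ l" for l
        using n[of l v h k] elim h kt by simp
      then show ?thesis
        unfolding Y_def total_claim_def using \<omega>(3) by (intro sum_mono sum_mono2) auto
    qed
    finally show ?case
      using kK unfolding solvent_def h_def by (auto simp: not_le)
  qed
qed

lemma lundberg_inequality:
  assumes \<theta>: "0 < \<theta>" and Psi: "Psi M base U delay r i \<theta> = 0" and r: "0 < r" and u: "0 < u"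
  shows "ruin_probability M imm delay claim r i u \<le> exp (- \<theta> * u)"
proof -
  define R where "R = {\<omega>\<in>space M. ruin_time imm delay claim r i u \<omega> < \<infinity>}"
  define Bad where "Bad v = {\<omega>\<in>space M.
    \<not> solvent i r (1 / Suc v) u (Suc v * Suc v) (block_path v (1 / Suc v) (Suc v * Suc v) \<omega>) \<omega>}" for v
  have Bad: "Bad v \<in> events" for v
  proof -
    have "Bad v = space M - {\<omega>\<in>space M.
        solvent i r (1 / Suc v) u (Suc v * Suc v) (block_path v (1 / Suc v) (Suc v * Suc v) \<omega>) \<omega>}"
      by (auto simp: Bad_def)
    then show ?thesis by (simp add: sets_solvent sets.compl_sets del: mult_Suc mult_Suc_right)
  qed
  have Bad_le: "prob (Bad v) \<le> exp (- \<theta> * u)" for v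
    unfolding Bad_def using \<theta> Psi u by (intro discrete_lundberg) auto
  \<comment> \<open>the events of the limit inferior; unlike the grid events they increase\<close>
  define L where "L n = (\<Inter>v\<in>{n..}. Bad v)" for n
  have L: "L n \<in> events" for n
    unfolding L_def using Bad by (intro sets.countable_INT') auto
  have "incseq L" by (auto simp: L_def incseq_def)
  then have "(\<lambda>n. prob (L n)) \<longlonglongrightarrow> prob (\<Union>n. L n)"
    using L by (intro finite_Lim_measure_incseq) auto
  moreover have "prob (L n) \<le> exp (- \<theta> * u)" for n
    using Bad by (intro order_trans[OF finite_measure_mono Bad_le[of n]]) (auto simp: L_def)
  ultimately have UL: "prob (\<Union>n. L n) \<le> exp (- \<theta> * u)"
    by (intro LIMSEQ_le_const2) auto
  have "prob R \<le> exp (- \<theta> * u)"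
  proof (cases "R \<in> events")
    case True
    have "AE \<omega> in M. \<omega> \<in> R \<longrightarrow> \<omega> \<in> (\<Union>n. L n)"
      using AE_locally_finite AE_claim_nonneg[of i] AE_space
    proof eventually_elim
      case (elim \<omega>)
      show ?case
      proof
        assume "\<omega> \<in> R"
        then have "\<forall>\<^sub>F v in sequentially. \<omega> \<in> Bad v"
          using ruin_discretised[OF elim(3,1,2) r u] elim(3) by (simp add: R_def Bad_def del: mult_Suc mult_Suc_right)
        then show "\<omega> \<in> (\<Union>n. L n)" by (auto simp: eventually_sequentially L_def)
      qed
    qed
    then have "prob R \<le> prob (\<Union>n. L n)"
      using L by (intro finite_measure_mono_AE) auto
    then show ?thesis using UL by simp
  \<comment> \<open>if the ruin event is not measurable, its measure is 0 by convention\<close>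
  qed (simp add: measure_notin_sets)
  then show ?thesis by (simp add: ruin_probability_def R_def)
qed

end

theorem mainTheorem5:
  fixes M :: "'w measure"
    and base :: "real ^ 'd::finite"
    and g :: "'d \<Rightarrow> 'd \<Rightarrow> real \<Rightarrow> real"
    and B :: "'d \<Rightarrow> (real ^ 'd) measure"
    and U :: "'d \<Rightarrow> (real ^ 's::finite) measure"
    and imm :: "'d \<Rightarrow> nat \<Rightarrow> 'w \<Rightarrow> ereal"
    and mark :: "'d event \<Rightarrow> 'w \<Rightarrow> real ^ 'd"
    and delay :: "'d event \<Rightarrow> 'd \<Rightarrow> nat \<Rightarrow> 'w \<Rightarrow> ereal"
    and claim :: "'d \<Rightarrow> nat \<Rightarrow> 'w \<Rightarrow> real ^ 's"
    and i :: 's and r \<theta> :: real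
  assumes hawkes: "compound_hawkes M base g B U imm mark delay claim"
    and A1: "assumption_A1 B g"
    and A2: "assumption_A2 B"
    and A3: "assumption_A3 B g U"
    and premium_pos: "0 < r"
    and net_profit: "(mean_row U i v* matrix_inv (mat 1 - branching_matrix B g)) \<bullet> base < r"
    and theta_pos: "0 < \<theta>"
    and adjustment: "Psi M base U delay r i \<theta> = 0"
  shows "\<forall>u>0. ruin_probability M imm delay claim r i u \<le> exp (- \<theta> * u)"
proof -
  interpret compound_hawkes M base g B U imm mark delay claim by (rule hawkes)
  show ?thesis
    using lundberg_inequality[OF theta_pos adjustment premium_pos] by blast
qed

end
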